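(* Let $\mathcal{P}^0_{\mathcal{A}}\subset\mathcal{A}$ be the set of elements of the form $(a_p\bmod p)_p$ where $(a_n)_{n\ge 0}$ is a recurrent sequence of rational numbers. Suppose $\alpha\in\mathcal{P}^0_{\mathcal{A}}$. Then there exists a non-zero polynomial $f(x)\in\mathbb{Q}[x]$ such that $f(\alpha)=0$ in $\mathcal{A}$, and every such $f(x)$ has a rational root.
   Context: $\mathcal{A}=\left(\prod_p\mathbb{F}_p\right)/\left(\bigoplus_p\mathbb{F}_p\right)$ over all rational primes $p$: elements are sequences $(a_p)_p$, $a_p\in\mathbb{F}_p$, two sequences being equal if they agree for all sufficiently large $p$ (so $a_p$ need only be defined for large $p$). $\mathbb{Q}$ embeds diagonally in $\mathcal{A}$, so $f(\alpha)$ makes sense for $f\in\mathbb{Q}[x]$. A recurrent sequence is a sequence satisfying a linear recurrence relation with constant coefficients. *)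

theory Defs
  imports
    Complex_Main
    "HOL-Number_Theory.Number_Theory"
    "HOL-Computational_Algebra.Computational_Algebra"
begin

text \<open>
  The ring \<open>\<A> = (\<Prod>\<^sub>p F\<^sub>p) / (\<Oplus>\<^sub>p F\<^sub>p)\<close>, with \<open>p\<close> running over the rational primes.  An element
  of \<open>F\<^sub>p\<close> is represented by an integer up to congruence modulo \<open>p\<close>, so a function
  \<open>nat \<Rightarrow> int\<close> represents a family \<open>(a\<^sub>p)\<^sub>p\<close>; its values at non-primes are ignored.  Passing
  to residue classes and dividing out the direct sum is done by a single equivalence relation.
\<close>

definition ring_A_eq :: "(nat \<Rightarrow> int) \<Rightarrow> (nat \<Rightarrow> int) \<Rightarrow> bool" where
  "ring_A_eq a b \<longleftrightarrow>
     (\<forall>\<^sub>F p in sequentially. prime p \<longrightarrow> [a p = b p] (mod int p))"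

lemma ring_A_eq_iff_finite:
  "ring_A_eq a b \<longleftrightarrow> finite {p. prime p \<and> \<not> [a p = b p] (mod int p)}"
proof -
  have "(\<forall>\<^sub>F p in sequentially. prime p \<longrightarrow> [a p = b p] (mod int p)) \<longleftrightarrow>
        (\<forall>\<^sub>F p in cofinite. prime p \<longrightarrow> [a p = b p] (mod int p))"
    by (simp add: cofinite_eq_sequentially)
  then show ?thesis
    by (simp add: ring_A_eq_def eventually_cofinite)
qed

lemma ring_A_eqI: "(\<And>p. a p = b p) \<Longrightarrow> ring_A_eq a b"
  by (simp add: ring_A_eq_def)

lemma equivp_ring_A_eq: "equivp ring_A_eq"
proof (rule equivpI)
  show "reflp ring_A_eq"
    by (auto simp: reflp_def ring_A_eq_def)
  show "symp ring_A_eq"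
    unfolding symp_def ring_A_eq_def
    by (intro allI impI, erule eventually_mono) (blast intro: cong_sym)
  show "transp ring_A_eq"
    unfolding transp_def ring_A_eq_def
    by (intro allI impI, erule (1) eventually_elim2) (blast intro: cong_trans)
qed

quotient_type ring_A = "nat \<Rightarrow> int" / ring_A_eq
  morphisms rep_ring_A mk_ring_A
  by (rule equivp_ring_A_eq)

lemma mk_ring_A_eq_iff:
  "mk_ring_A a = mk_ring_A b \<longleftrightarrow>
     (\<forall>\<^sub>F p in sequentially. prime p \<longrightarrow> [a p = b p] (mod int p))"
  by (simp add: ring_A.abs_eq_iff ring_A_eq_def)

instantiation ring_A :: comm_ring_1
begin

lift_definition zero_ring_A :: ring_A is "\<lambda>p. 0" .

lift_definition one_ring_A :: ring_A is "\<lambda>p. 1" .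

lift_definition plus_ring_A :: "ring_A \<Rightarrow> ring_A \<Rightarrow> ring_A" is "\<lambda>a b p. a p + b p"
  unfolding ring_A_eq_def by (erule (1) eventually_elim2) (blast intro: cong_add)

lift_definition minus_ring_A :: "ring_A \<Rightarrow> ring_A \<Rightarrow> ring_A" is "\<lambda>a b p. a p - b p"
  unfolding ring_A_eq_def by (erule (1) eventually_elim2) (blast intro: cong_diff)

lift_definition uminus_ring_A :: "ring_A \<Rightarrow> ring_A" is "\<lambda>a p. - a p"
  unfolding ring_A_eq_def by (erule eventually_mono) (simp add: cong_minus_minus_iff)

lift_definition times_ring_A :: "ring_A \<Rightarrow> ring_A \<Rightarrow> ring_A" is "\<lambda>a b p. a p * b p"
  unfolding ring_A_eq_def by (erule (1) eventually_elim2) (blast intro: cong_mult)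

instance
proof
  show "(0 :: ring_A) \<noteq> 1"
  proof
    assume "(0 :: ring_A) = 1"
    then have "\<forall>\<^sub>F p in sequentially. prime p \<longrightarrow> [0 = 1] (mod int p)"
      by transfer (simp add: ring_A_eq_def)
    then obtain N where N: "\<And>p. p \<ge> N \<Longrightarrow> prime p \<Longrightarrow> [0 = 1] (mod int p)"
      by (auto simp: eventually_sequentially)
    obtain p :: nat where "prime p" "p > N"
      using bigger_prime by blast
    with N[of p] prime_gt_1_nat[of p] show False
      by (auto simp: cong_def)
  qed
qed (transfer, rule ring_A_eqI, simp add: algebra_simps)+

end


text \<open>
  Reduction of a rational number modulo a prime.  If \<open>p\<close> divides the denominator of \<open>r\<close>
  (\<open>quotient_of\<close> gives the fraction in lowest terms), the result is the junk value \<open>0\<close>.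
\<close>

definition rat_mod :: "nat \<Rightarrow> rat \<Rightarrow> int" where
  "rat_mod p r =
     fst (quotient_of r) * modular_inverse (int p) (snd (quotient_of r)) mod int p"

definition p_integral :: "nat \<Rightarrow> rat \<Rightarrow> bool" where
  "p_integral p r \<longleftrightarrow> coprime (snd (quotient_of r)) (int p)"

text \<open>
  Both maps below fix junk values only at finitely many primes: a single rational number, and
  likewise (lemma \<open>recurrent_p_integral\<close>) a recurrent sequence as a whole, is \<open>p\<close>-integral for
  all large \<open>p\<close>.
\<close>

definition rat_to_A :: "rat \<Rightarrow> ring_A" where
  "rat_to_A r = mk_ring_A (\<lambda>p. rat_mod p r)"

definition seq_to_A :: "(nat \<Rightarrow> rat) \<Rightarrow> ring_A" where
  "seq_to_A a = mk_ring_A (\<lambda>p. rat_mod p (a p))"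

definition recurrent :: "(nat \<Rightarrow> rat) \<Rightarrow> bool" where
  "recurrent a \<longleftrightarrow>
     (\<exists>(k :: nat) (c :: nat \<Rightarrow> rat). \<forall>n. a (n + k) = (\<Sum>i<k. c i * a (n + i)))"

definition P0_A :: "ring_A set" where
  "P0_A = {seq_to_A a | a. recurrent a}"

definition eval_A :: "rat poly \<Rightarrow> ring_A \<Rightarrow> ring_A" where
  "eval_A f \<alpha> = poly (map_poly rat_to_A f) \<alpha>"


lemma rat_mod_unique:
  assumes "prime p" "p_integral p r" "of_int b * r = of_int a" "coprime b (int p)"
  shows "[x = rat_mod p r] (mod int p) \<longleftrightarrow> [b * x = a] (mod int p)"
proof -
  obtain m d where q: "quotient_of r = (m, d)"
    by (cases "quotient_of r")
  have d: "d > 0" and r: "r = of_int m / of_int d" and cop: "coprime d (int p)"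
    using q quotient_of_denom_pos[OF q] quotient_of_div[OF q] assms(2)
    by (auto simp: p_integral_def)
  let ?i = "modular_inverse (int p) d"
  have "of_int (b * m) = (of_int (a * d) :: rat)"
    using assms(3) d r by (simp add: field_simps)
  then have bm: "b * m = a * d"
    by (simp only: of_int_eq_iff)
  have "[b * (m * ?i) = a * (d * ?i)] (mod int p)"
    by (simp add: bm flip: mult.assoc)
  also have "[a * (d * ?i) = a * 1] (mod int p)"
    by (intro cong_mult cong_refl cong_modular_inverse1 cop)
  finally have *: "[b * rat_mod p r = a] (mod int p)"
    by (simp add: rat_mod_def q cong_def mod_mult_right_eq)
  have "[x = rat_mod p r] (mod int p) \<longleftrightarrow> [b * x = b * rat_mod p r] (mod int p)"
    using cong_mult_lcancel[OF assms(4)] by simp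
  also have "\<dots> \<longleftrightarrow> [b * x = a] (mod int p)"
    using * by (blast intro: cong_trans cong_sym)
  finally show ?thesis .
qed

lemma rat_mod_mult_denom:
  assumes "p_integral p r"
  shows "[snd (quotient_of r) * rat_mod p r = fst (quotient_of r)] (mod int p)"
proof -
  let ?d = "snd (quotient_of r)" and ?m = "fst (quotient_of r)"
  have "[?m * (?d * modular_inverse (int p) ?d) = ?m * 1] (mod int p)"
    using assms by (intro cong_mult cong_refl cong_modular_inverse1) (simp add: p_integral_def)
  then show ?thesis
    by (simp add: rat_mod_def cong_def mod_mult_right_eq mult_ac)
qed

lemma p_integralI:
  assumes "coprime b (int p)" "of_int b * r = of_int a"
  shows "p_integral p r"
proof -
  obtain m d where q: "quotient_of r = (m, d)"
    by (cases "quotient_of r")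
  have d: "d > 0" and r: "r = of_int m / of_int d" and md: "coprime m d"
    using quotient_of_denom_pos[OF q] quotient_of_div[OF q] quotient_of_coprime[OF q] by auto
  have "of_int (b * m) = (of_int (a * d) :: rat)"
    using assms(2) d r by (simp add: field_simps)
  then have "b * m = a * d"
    by (simp only: of_int_eq_iff)
  then have "d dvd b * m"
    by simp
  moreover have "coprime d m"
    using md by (simp add: coprime_commute)
  ultimately have "d dvd b"
    by (simp add: coprime_dvd_mult_left_iff)
  then have "coprime d (int p)"
    by (rule coprime_divisors[OF _ dvd_refl assms(1)])
  then show ?thesis
    by (simp add: p_integral_def q)
qed

lemma p_integral_add_mult:
  assumes "p_integral p r" "p_integral p s"
  shows "p_integral p (r + s)" "p_integral p (r * s)"
proof -
  obtain m d m' d' where q: "quotient_of r = (m, d)" "quotient_of s = (m', d')"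
    by (metis surj_pair)
  have d: "d > 0" "d' > 0" "r = of_int m / of_int d" "s = of_int m' / of_int d'"
    using q quotient_of_denom_pos quotient_of_div by blast+
  have c: "coprime (d * d') (int p)"
    using assms q by (simp add: p_integral_def)
  show "p_integral p (r + s)"
    by (rule p_integralI[OF c, of _ "m * d' + m' * d"])
       (unfold d(3,4), use d(1,2) in \<open>simp add: field_simps\<close>)
  show "p_integral p (r * s)"
    by (rule p_integralI[OF c, of _ "m * m'"])
       (unfold d(3,4), use d(1,2) in \<open>simp add: field_simps\<close>)
qed

lemma eventually_p_integral:
  "\<forall>\<^sub>F p in sequentially. prime p \<longrightarrow> p_integral p r"
proof -
  obtain m d where q: "quotient_of r = (m, d)"
    by (cases "quotient_of r")
  have d: "d > 0"
    using quotient_of_denom_pos[OF q] .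
  have "p_integral p r" if "p > nat d" "prime p" for p
  proof -
    have "\<not> int p dvd d"
      using that d zdvd_imp_le[of "int p" d] by auto
    then have "coprime (int p) d"
      using that by (intro prime_imp_coprime) auto
    then show ?thesis
      by (simp add: p_integral_def q coprime_commute)
  qed
  then show ?thesis
    unfolding eventually_sequentially by (intro exI[of _ "Suc (nat d)"]) auto
qed

lemma recurrent_p_integral:
  assumes "recurrent a"
  shows "\<forall>\<^sub>F p in sequentially. prime p \<longrightarrow> (\<forall>n. p_integral p (a n))"
proof -
  obtain k c where rec: "\<And>n. a (n + k) = (\<Sum>i<k. c i * a (n + i))"
    using assms by (auto simp: recurrent_def)
  have "\<forall>\<^sub>F p in sequentially. \<forall>i\<in>{..<k}. prime p \<longrightarrow> p_integral p (c i) \<and> p_integral p (a i)"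
  proof (intro eventually_ball_finite ballI)
    fix i
    show "\<forall>\<^sub>F p in sequentially. prime p \<longrightarrow> p_integral p (c i) \<and> p_integral p (a i)"
      using eventually_p_integral[of "c i"] eventually_p_integral[of "a i"]
      by eventually_elim blast
  qed simp
  then show ?thesis
  proof (rule eventually_mono, intro impI allI)
    fix p n
    assume p: "\<forall>i\<in>{..<k}. prime p \<longrightarrow> p_integral p (c i) \<and> p_integral p (a i)" "prime p"
    show "p_integral p (a n)"
    proof (induction n rule: less_induct)
      case (less n)
      show ?case
      proof (cases "n < k")
        case True
        then show ?thesis using p by auto
      next
        case False
        have "p_integral p (\<Sum>i\<in>I. c i * a (n - k + i))" if "finite I" "I \<subseteq> {..<k}" for I
          using that
        proof (induction I rule: finite_induct)
          case empty
          show ?case by (simp add: p_integral_def)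
        next
          case (insert i I)
          have "p_integral p (a (n - k + i))"
            using False insert.prems by (intro less.IH) auto
          then show ?case
            using insert p by (auto intro!: p_integral_add_mult)
        qed
        then have "p_integral p (\<Sum>i<k. c i * a (n - k + i))"
          by blast
        then show ?thesis
          using rec[of "n - k"] False by simp
      qed
    qed
  qed
qed

lemma rat_mod_add_mult:
  assumes "prime p" "p_integral p r" "p_integral p s"
  shows "[rat_mod p r + rat_mod p s = rat_mod p (r + s)] (mod int p)"
    and "[rat_mod p r * rat_mod p s = rat_mod p (r * s)] (mod int p)"
proof -
  obtain m d m' d' where q: "quotient_of r = (m, d)" "quotient_of s = (m', d')"
    by (metis surj_pair)
  have d: "d > 0" "d' > 0" "r = of_int m / of_int d" "s = of_int m' / of_int d'"
    using q quotient_of_denom_pos quotient_of_div by blast+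
  have c: "coprime (d * d') (int p)"
    using assms q by (simp add: p_integral_def)
  have rs: "of_int (d * d') * (r + s) = of_int (d' * m + d * m')"
           "of_int (d * d') * (r * s) = of_int (m * m')"
    unfolding d(3,4) using d(1,2) by (simp_all add: field_simps)
  have 1: "[d * rat_mod p r = m] (mod int p)" "[d' * rat_mod p s = m'] (mod int p)"
    using rat_mod_mult_denom[OF assms(2)] rat_mod_mult_denom[OF assms(3)] q by auto
  have "[d' * (d * rat_mod p r) + d * (d' * rat_mod p s) = d' * m + d * m'] (mod int p)"
    by (intro cong_add cong_mult cong_refl 1)
  then have "[d * d' * (rat_mod p r + rat_mod p s) = d' * m + d * m'] (mod int p)"
    by (simp add: algebra_simps)
  then show "[rat_mod p r + rat_mod p s = rat_mod p (r + s)] (mod int p)"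
    by (rule iffD2[OF rat_mod_unique[OF assms(1) p_integral_add_mult(1)[OF assms(2,3)] rs(1) c]])
  have "[(d * rat_mod p r) * (d' * rat_mod p s) = m * m'] (mod int p)"
    by (intro cong_mult 1)
  then have "[d * d' * (rat_mod p r * rat_mod p s) = m * m'] (mod int p)"
    by (simp add: algebra_simps)
  then show "[rat_mod p r * rat_mod p s = rat_mod p (r * s)] (mod int p)"
    by (rule iffD2[OF rat_mod_unique[OF assms(1) p_integral_add_mult(2)[OF assms(2,3)] rs(2) c]])
qed

lemma rat_to_A_0: "rat_to_A 0 = 0"
  by (simp add: rat_to_A_def zero_ring_A_def rat_mod_def)

lemma rat_to_A_1: "rat_to_A 1 = 1"
  unfolding rat_to_A_def one_ring_A_def mk_ring_A_eq_iff
  by (rule always_eventually) (auto simp: rat_mod_def cong_def dest: prime_gt_1_nat)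

lemma rat_to_A_add: "rat_to_A (r + s) = rat_to_A r + rat_to_A s"
  unfolding rat_to_A_def plus_ring_A.abs_eq mk_ring_A_eq_iff
  using eventually_p_integral[of r] eventually_p_integral[of s]
  by eventually_elim (blast intro: cong_sym rat_mod_add_mult)

lemma rat_to_A_mult: "rat_to_A (r * s) = rat_to_A r * rat_to_A s"
  unfolding rat_to_A_def times_ring_A.abs_eq mk_ring_A_eq_iff
  using eventually_p_integral[of r] eventually_p_integral[of s]
  by eventually_elim (blast intro: cong_sym rat_mod_add_mult)

lemma inj_rat_to_A: "inj rat_to_A"
proof (rule injI, rule ccontr)
  fix r s
  assume eq: "rat_to_A r = rat_to_A s" and ne: "r \<noteq> s"
  have "rat_to_A (r - s) + rat_to_A s = 0 + rat_to_A s"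
    by (simp flip: rat_to_A_add add: eq)
  then have "rat_to_A (r - s) = 0"
    by simp
  then have "rat_to_A ((r - s) * inverse (r - s)) = 0"
    by (simp only: rat_to_A_mult) simp
  with ne show False
    by (simp add: rat_to_A_1)
qed

end

theory Submission
  imports Defs "HOL-Library.FuncSet" "HOL-Computational_Algebra.Field_as_Ring"
begin

text \<open>
  Let \<open>s\<close> be the semisimple part of \<open>X\<close> modulo the characteristic polynomial of the recurrence.
  Since \<open>X ^ p\<close> and \<open>s ^ p\<close> agree modulo large \<open>p\<close>, the sequence may be replaced by one of the form
  \<open>b n = (\<Sum>\<lambda>\<in>\<Lambda>. c \<lambda> * \<lambda> ^ n)\<close> with constants \<open>c \<lambda>\<close>, where \<open>\<Lambda>\<close> is the set of roots of a
  separable rational polynomial.  All \<open>\<lambda>\<close> and \<open>c \<lambda>\<close> lie in a number field \<open>\<rat>(\<theta>)\<close>.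

  Frobenius permutes \<open>\<Lambda>\<close> modulo \<open>p\<close>, so \<open>b p\<close> is a root of a product of rational polynomials that
  annihilate the finitely many sums \<open>\<Sum>\<lambda>\<in>\<Lambda>. c \<lambda> * \<sigma> \<lambda>\<close>, with \<open>\<sigma> : \<Lambda> \<rightarrow> \<Lambda>\<close>.  Conversely, there are
  infinitely many primes \<open>p\<close> modulo which the minimal polynomial of \<open>\<theta>\<close> has a root.  For these
  \<open>\<lambda> ^ p\<close> reduces to \<open>\<lambda>\<close>, so \<open>b p\<close> is congruent to the rational number \<open>b 1\<close>, which is therefore
  a root of every \<open>f\<close> that annihilates \<open>\<alpha>\<close>.
\<close>

section \<open>Subrings and monic division\<close>

text \<open>Subrings are carrier sets inside a fixed ring type, so that rational numbers,
  polynomials and complex numbers share one list of closure rules.\<close>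

locale comm_subring =
  fixes R :: "'a::comm_ring_1 set"
  assumes one_mem: "1 \<in> R"
    and diff_mem: "x \<in> R \<Longrightarrow> y \<in> R \<Longrightarrow> x - y \<in> R"
    and mult_mem: "x \<in> R \<Longrightarrow> y \<in> R \<Longrightarrow> x * y \<in> R"
begin

lemma zero_mem: "0 \<in> R"
  using diff_mem[OF one_mem one_mem] by simp

lemma uminus_mem: "x \<in> R \<Longrightarrow> - x \<in> R"
  using diff_mem[OF zero_mem, of x] by simp

lemma add_mem: "x \<in> R \<Longrightarrow> y \<in> R \<Longrightarrow> x + y \<in> R"
  using diff_mem[of x "- y"] uminus_mem[of y] by simp

lemma sum_mem: "(\<And>i. i \<in> I \<Longrightarrow> f i \<in> R) \<Longrightarrow> sum f I \<in> R"
  by (induction I rule: infinite_finite_induct) (auto intro: zero_mem add_mem)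

lemma prod_mem: "(\<And>i. i \<in> I \<Longrightarrow> f i \<in> R) \<Longrightarrow> prod f I \<in> R"
  by (induction I rule: infinite_finite_induct) (auto intro: one_mem mult_mem)

lemma power_mem: "x \<in> R \<Longrightarrow> x ^ n \<in> R"
  by (induction n) (auto intro: one_mem mult_mem)

lemma of_nat_mem: "of_nat n \<in> R"
  by (induction n) (auto intro: zero_mem one_mem add_mem)

lemmas closed = zero_mem one_mem uminus_mem add_mem diff_mem mult_mem sum_mem prod_mem power_mem of_nat_mem

lemma image_comm_subring:
  fixes f :: "'a \<Rightarrow> 'b::comm_ring_1"
  assumes "f 1 = 1" "\<And>x y. f (x - y) = f x - f y" "\<And>x y. f (x * y) = f x * f y"
  shows "comm_subring (f ` R)"
  using assms closed by unfold_locales (metis image_iff, (auto simp flip: assms(2,3))[2])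

text \<open>The image of \<open>R\<close> under multiplication by \<open>c\<close> is the ideal
  \<open>c R\<close>; this and the next lemmas are its closure rules. Most congruences modulo
  \<open>p\<close> below are phrased as membership in such an ideal.\<close>

lemma multiple_add: "x \<in> (*) c ` R \<Longrightarrow> y \<in> (*) c ` R \<Longrightarrow> x + y \<in> (*) c ` R"
  by (auto simp flip: distrib_left intro: add_mem)

lemma multiple_diff: "x \<in> (*) c ` R \<Longrightarrow> y \<in> (*) c ` R \<Longrightarrow> x - y \<in> (*) c ` R"
  by (auto simp flip: right_diff_distrib intro: diff_mem)

lemma multiple_mult: "x \<in> (*) c ` R \<Longrightarrow> y \<in> R \<Longrightarrow> x * y \<in> (*) c ` R"
  by (auto simp: mult.assoc intro: mult_mem)

lemma multiple_mult': "x \<in> (*) c ` R \<Longrightarrow> y \<in> R \<Longrightarrow> y * x \<in> (*) c ` R"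
  using multiple_mult[of x c y] by (simp add: mult.commute)

lemma multiple_zero: "0 \<in> (*) c ` R"
  using zero_mem by (auto intro!: image_eqI[of _ _ 0])

lemma multiple_sum: "(\<And>i. i \<in> I \<Longrightarrow> f i \<in> (*) c ` R) \<Longrightarrow> sum f I \<in> (*) c ` R"
  by (induction I rule: infinite_finite_induct) (auto intro: multiple_zero multiple_add)

end

section \<open>Polynomials with coefficients in a subring\<close>

definition coeffs_in :: "'a::zero set \<Rightarrow> 'a poly set" where
  "coeffs_in R = {h. \<forall>i. coeff h i \<in> R}"

lemma coeffs_in_pCons_iff: "pCons a h \<in> coeffs_in R \<longleftrightarrow> a \<in> R \<and> h \<in> coeffs_in R"
  by (auto simp: coeffs_in_def coeff_pCons split: nat.splits)

context comm_subring
begin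

lemma coeffs_in_comm_subring: "comm_subring (coeffs_in R)"
  by unfold_locales (auto simp: coeffs_in_def coeff_mult intro!: closed)

lemma smult_coeffs_in: "a \<in> R \<Longrightarrow> h \<in> coeffs_in R \<Longrightarrow> smult a h \<in> coeffs_in R"
  by (auto simp: coeffs_in_def intro: closed)

lemma poly_coeffs_in: "h \<in> coeffs_in R \<Longrightarrow> x \<in> R \<Longrightarrow> poly h x \<in> R"
  by (induction h) (auto simp: coeffs_in_pCons_iff intro: closed)

lemma pcompose_coeffs_in:
  assumes "h \<in> coeffs_in R" "g \<in> coeffs_in R"
  shows "pcompose h g \<in> coeffs_in R"
proof -
  interpret P: comm_subring "coeffs_in R" by (rule coeffs_in_comm_subring)
  show ?thesis
    using assms
    by (induction h)
       (auto simp: coeffs_in_pCons_iff pcompose_pCons zero_mem P.zero_mem intro!: P.add_mem P.mult_mem)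
qed

text \<open>Long division: as \<open>g\<close> is monic, cancelling the leading term of
  \<open>h\<close> needs no inverse, so all coefficients stay in \<open>R\<close>.\<close>

lemma monic_division:
  assumes g: "g \<in> coeffs_in R" "lead_coeff g = 1" and h: "h \<in> coeffs_in R"
  shows "\<exists>q\<in>coeffs_in R. \<exists>r\<in>coeffs_in R. h = g * q + r \<and> (r = 0 \<or> degree r < degree g)"
  using h
proof (induction "degree h" arbitrary: h rule: less_induct)
  case less
  interpret P: comm_subring "coeffs_in R" by (rule coeffs_in_comm_subring)
  show ?case
  proof (cases "h = 0 \<or> degree h < degree g")
    case True
    then show ?thesis
      using less.prems P.zero_mem by (intro bexI[of _ 0] bexI[of _ h]) auto
  next
    case False
    define m where "m = monom (lead_coeff h) (degree h - degree g)"
    have m: "m \<in> coeffs_in R"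
      using less.prems by (auto simp: m_def coeffs_in_def intro: closed)
    let ?h = "h - g * m"
    have h': "?h \<in> coeffs_in R"
      using less.prems g m by (intro P.closed)
    have gm: "coeff (g * m) (degree h) = lead_coeff h"
    proof -
      have "degree m = degree h - degree g" "lead_coeff m = lead_coeff h"
        using False by (simp_all add: m_def degree_monom_eq)
      then show ?thesis
        using coeff_mult_degree_sum[of g m] g False by simp
    qed
    have "degree (g * m) \<le> degree h"
      using degree_mult_le[of g m] degree_monom_le[of "lead_coeff h" "degree h - degree g"] False
      unfolding m_def by linarith
    then have le: "degree ?h \<le> degree h"
      by (intro degree_diff_le) auto
    show ?thesis
    proof (cases "?h = 0")
      case True
      then show ?thesis
        using m P.zero_mem by (intro bexI[of _ m] bexI[of _ 0]) auto
    next
      case F: False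
      have "degree ?h \<noteq> degree h"
        using gm F by (metis coeff_diff diff_self leading_coeff_0_iff)
      then obtain q r where "q \<in> coeffs_in R" "r \<in> coeffs_in R" "?h = g * q + r"
        "r = 0 \<or> degree r < degree g"
        using less.hyps[of ?h] le h' by (auto simp: less_le)
      then show ?thesis
        using m by (intro bexI[of _ "q + m"] bexI[of _ r]) (auto simp: algebra_simps intro: P.closed)
    qed
  qed
qed

end

text \<open>A prime \<open>p\<close> divides \<open>p choose k\<close> for \<open>0 < k < p\<close>.
  The cofactor of \<open>p\<close> is written out so that it visibly lies in every subring
  containing \<open>x\<close> and \<open>y\<close>.\<close>

lemma binomial_prime:
  fixes x y :: "'a::comm_ring_1"
  assumes "prime p"
  shows "(x + y) ^ p = x ^ p + y ^ p +
           of_nat p * (\<Sum>k\<in>{0<..<p}. of_nat ((p choose k) div p) * x ^ k * y ^ (p - k))"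
proof -
  have p: "p > 0" using assms prime_gt_0_nat by blast
  have "{..p} = insert 0 (insert p {0<..<p})" using p by auto
  then have "(x + y) ^ p =
      x ^ p + y ^ p + (\<Sum>k\<in>{0<..<p}. of_nat (p choose k) * x ^ k * y ^ (p - k))"
    using p by (simp add: binomial_ring algebra_simps)
  also have "(\<Sum>k\<in>{0<..<p}. of_nat (p choose k) * x ^ k * y ^ (p - k)) =
      of_nat p * (\<Sum>k\<in>{0<..<p}. of_nat ((p choose k) div p) * x ^ k * y ^ (p - k))"
    unfolding sum_distrib_left
  proof (rule sum.cong)
    fix k assume "k \<in> {0<..<p}"
    then have "p dvd (p choose k)" using assms by (intro dvd_choose_prime) auto
    then have "of_nat (p choose k) = (of_nat p * of_nat ((p choose k) div p) :: 'a)"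
      by (metis dvd_mult_div_cancel of_nat_mult)
    then show "of_nat (p choose k) * x ^ k * y ^ (p - k) =
        of_nat p * (of_nat ((p choose k) div p) * x ^ k * y ^ (p - k))"
      by (simp add: mult.assoc)
  qed auto
  finally show ?thesis .
qed

lemma (in comm_subring) power_prime_add_multiple:
  assumes "prime p" "x \<in> R" "y \<in> R"
  shows "(x + y) ^ p - (x ^ p + y ^ p) \<in> (*) (of_nat p) ` R"
  unfolding binomial_prime[OF assms(1)] using assms
  by (auto intro!: image_eqI[OF _ sum_mem] closed)

section \<open>The ring of p-integral rational numbers\<close>

text \<open>For a prime \<open>p\<close> this is the localisation Z_(p) of the integers.\<close>

definition zp :: "nat \<Rightarrow> rat set" where
  "zp p = {r. p_integral p r}"

lemma of_int_zp: "of_int m \<in> zp p"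
  by (simp add: zp_def p_integral_def)

lemma zp_comm_subring: "comm_subring (zp p)"
proof
  show "1 \<in> zp p" using of_int_zp[of 1] by simp
  show "x * y \<in> zp p" if "x \<in> zp p" "y \<in> zp p" for x y
    using that p_integral_add_mult by (simp add: zp_def)
  show "x - y \<in> zp p" if "x \<in> zp p" "y \<in> zp p" for x y
    using that p_integral_add_mult(1)[of p x "- 1 * y"] p_integral_add_mult(2)[of p "- 1" y]
      of_int_zp[of "-1"] by (simp add: zp_def)
qed

interpretation zp: comm_subring "zp p"
  by (rule zp_comm_subring)

interpretation zp_poly: comm_subring "coeffs_in (zp p)"
  by (rule zp.coeffs_in_comm_subring)

lemma eventually_coeffs_in_zp:
  "\<forall>\<^sub>F p in sequentially. prime p \<longrightarrow> h \<in> coeffs_in (zp p)"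
proof (induction h)
  case 0
  show ?case by (simp add: zp_poly.zero_mem)
next
  case (pCons a h)
  show ?case
    using pCons.IH eventually_p_integral[of a]
    by eventually_elim (auto simp: coeffs_in_pCons_iff zp_def)
qed

text \<open>The denominator is invertible modulo \<open>p\<close>, so the residue vanishes exactly
  when \<open>p\<close> divides the numerator; cancelling \<open>p\<close> there leaves a
  denominator prime to \<open>p\<close>.\<close>

lemma rat_mod_eq_0_iff:
  assumes "prime p" "r \<in> zp p"
  shows "[rat_mod p r = 0] (mod int p) \<longleftrightarrow> r \<in> (*) (of_nat p) ` zp p"
proof
  obtain m d where q: "quotient_of r = (m, d)"
    by (cases "quotient_of r")
  have d: "d > 0" "r = of_int m / of_int d" and cop: "coprime d (int p)"
    using q quotient_of_denom_pos[OF q] quotient_of_div[OF q] assms(2)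
    by (auto simp: p_integral_def zp_def)
  have p0: "p > 0" using assms(1) prime_gt_0_nat by blast
  assume "[rat_mod p r = 0] (mod int p)"
  then have "[d * rat_mod p r = d * 0] (mod int p)"
    by (intro cong_mult cong_refl)
  moreover have "[d * rat_mod p r = m] (mod int p)"
    using rat_mod_mult_denom[of p r] assms q by (simp add: zp_def)
  ultimately have "[m = 0] (mod int p)"
    by (metis cong_sym cong_trans mult_zero_right)
  then obtain k where k: "m = int p * k"
    by (auto simp: cong_0_iff)
  have "of_int d * (of_int k / of_int d) = (of_int k :: rat)"
    using d by simp
  then have "of_int k / of_int d \<in> zp p"
    using p_integralI[OF cop] by (simp add: zp_def)
  then show "r \<in> (*) (of_nat p) ` zp p"
    using d k by (intro image_eqI[of _ _ "of_int k / of_int d"]) auto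
next
  assume "r \<in> (*) (of_nat p) ` zp p"
  then obtain t where t: "r = of_nat p * t" "t \<in> zp p" by auto
  have "of_nat p \<in> zp p" by (rule zp.of_nat_mem)
  then have "[rat_mod p r = rat_mod p (of_nat p) * rat_mod p t] (mod int p)"
    using rat_mod_add_mult(2)[OF assms(1), of "of_nat p" t] t by (auto simp: zp_def cong_sym)
  moreover have "quotient_of (of_nat p) = (int p, 1)"
    using quotient_of_int[of "int p"] by simp
  then have "rat_mod p (of_nat p) = 0"
    by (simp add: rat_mod_def)
  ultimately show "[rat_mod p r = 0] (mod int p)" by simp
qed

lemma rat_mod_cong_iff:
  assumes "prime p" "r \<in> zp p" "s \<in> zp p"
  shows "[rat_mod p r = rat_mod p s] (mod int p) \<longleftrightarrow> r - s \<in> (*) (of_nat p) ` zp p"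
proof -
  have "[rat_mod p (r - s) + rat_mod p s = rat_mod p (r - s + s)] (mod int p)"
    using assms zp.diff_mem[of r p s] by (intro rat_mod_add_mult) (auto simp: zp_def)
  then have "[rat_mod p r = rat_mod p s] (mod int p) \<longleftrightarrow>
      [rat_mod p (r - s) + rat_mod p s = 0 + rat_mod p s] (mod int p)"
    by (simp add: cong_def)
  also have "\<dots> \<longleftrightarrow> [rat_mod p (r - s) = 0] (mod int p)"
    by (rule cong_add_rcancel)
  finally show ?thesis
    using rat_mod_eq_0_iff[OF assms(1) zp.diff_mem[OF assms(2,3)]] by simp
qed

text \<open>Reduction is multiplicative on Z_(p), so this is Fermat's little theorem in the prime
  field.\<close>

lemma fermat_zp:
  assumes "prime p" "r \<in> zp p"
  shows "r ^ p - r \<in> (*) (of_nat p) ` zp p"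
proof -
  have "[rat_mod p (r ^ n) = rat_mod p r ^ n] (mod int p)" for n
  proof (induction n)
    case 0
    have "[rat_mod p 1 = 1] (mod int p)"
      using cong_modular_inverse1[of 1 "int p"] by (simp add: rat_mod_def)
    then show ?case by simp
  next
    case (Suc n)
    have "[rat_mod p (r * r ^ n) = rat_mod p r * rat_mod p (r ^ n)] (mod int p)"
      using assms zp.power_mem[of r p n] by (intro cong_sym[OF rat_mod_add_mult(2)]) (auto simp: zp_def)
    also have "[rat_mod p r * rat_mod p (r ^ n) = rat_mod p r * rat_mod p r ^ n] (mod int p)"
      by (intro cong_mult cong_refl Suc.IH)
    finally show ?case by simp
  qed
  also have "[rat_mod p r ^ p = rat_mod p r] (mod int p)"
  proof -
    define z where "z = rat_mod p r"
    show ?thesis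
    proof (cases "int p dvd z")
      case True
      moreover have "p > 0" using assms(1) prime_gt_0_nat by blast
      ultimately have "int p dvd z ^ p - z"
        by (intro dvd_diff) (auto intro: dvd_power_le dvd_trans[OF _ dvd_power])
      then show ?thesis by (simp add: z_def cong_iff_dvd_diff)
    next
      case False
      \<comment> \<open>\<open>fermat_theorem\<close> speaks of natural numbers, hence the passage
        to the least non-negative residue.\<close>
      define y where "y = nat (z mod int p)"
      have y: "[int y = z] (mod int p)"
        using assms(1) prime_gt_0_nat by (simp add: y_def cong_def)
      then have "\<not> p dvd y"
        using False by (metis cong_dvd_iff cong_sym int_dvd_int_iff)
      then have "[y ^ (p - 1) = 1] (mod p)"
        by (rule fermat_theorem[OF assms(1)])
      then have "[y ^ (p - 1) * y = 1 * y] (mod p)"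
        by (intro cong_mult cong_refl)
      then have "[y ^ p = y] (mod p)"
        using prime_gt_0_nat[OF assms(1)] by (simp flip: power_Suc2)
      then have "[int y ^ p = int y] (mod int p)"
        by (metis cong_int_iff of_nat_power)
      then show ?thesis
        using y unfolding z_def by (metis cong_pow cong_sym cong_trans)
    qed
  qed
  finally show ?thesis
    using rat_mod_cong_iff[OF assms(1) zp.power_mem[OF assms(2)] assms(2)] by simp
qed

section \<open>Computing in \<open>ring_A\<close> through p-integral representatives\<close>

lemma seq_to_A_eq_iff:
  assumes "\<forall>\<^sub>F p in sequentially. prime p \<longrightarrow> (\<forall>n. a n \<in> zp p)"
    and "\<forall>\<^sub>F p in sequentially. prime p \<longrightarrow> (\<forall>n. b n \<in> zp p)"
  shows "seq_to_A a = seq_to_A b \<longleftrightarrow>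
    (\<forall>\<^sub>F p in sequentially. prime p \<longrightarrow> a p - b p \<in> (*) (of_nat p) ` zp p)"
  unfolding seq_to_A_def mk_ring_A_eq_iff
  by (rule eventually_cong[OF eventually_conj[OF assms]]) (auto simp: rat_mod_cong_iff)

text \<open>Induction along Horner's scheme: reduction modulo \<open>p\<close> respects sums and
  products of \<open>p\<close>-integral numbers, and integrality of all numbers involved fails for
  only finitely many primes.\<close>

lemma eval_A_seq_to_A:
  assumes "\<forall>\<^sub>F p in sequentially. prime p \<longrightarrow> (\<forall>n. b n \<in> zp p)"
  shows "eval_A f (seq_to_A b) = seq_to_A (\<lambda>p. poly f (b p))"
proof (induction f)
  case 0
  show ?case by (simp add: eval_A_def seq_to_A_def rat_mod_def zero_ring_A_def)
next
  case (pCons a f)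
  have "eval_A (pCons a f) (seq_to_A b) = rat_to_A a + seq_to_A b * eval_A f (seq_to_A b)"
    using rat_to_A_0 by (simp add: eval_A_def map_poly_pCons)
  also have "\<dots> = rat_to_A a + seq_to_A b * seq_to_A (\<lambda>p. poly f (b p))"
    by (simp add: pCons.IH)
  also have "\<dots> = seq_to_A (\<lambda>p. poly (pCons a f) (b p))"
    unfolding rat_to_A_def seq_to_A_def plus_ring_A.abs_eq times_ring_A.abs_eq mk_ring_A_eq_iff
    using eventually_p_integral[of a] assms eventually_coeffs_in_zp[of f]
  proof eventually_elim
    case (elim p)
    show ?case
    proof
      assume p: "prime p"
      have f: "poly f (b p) \<in> zp p"
        using elim p by (intro zp.poly_coeffs_in) auto
      have "[rat_mod p a + rat_mod p (b p) * rat_mod p (poly f (b p))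
           = rat_mod p a + rat_mod p (b p * poly f (b p))] (mod int p)"
        using f elim p by (intro cong_add cong_refl rat_mod_add_mult) (auto simp: zp_def)
      also have "[rat_mod p a + rat_mod p (b p * poly f (b p)) =
          rat_mod p (a + b p * poly f (b p))] (mod int p)"
        using f elim p zp.mult_mem[of "b p" p, OF _ f]
        by (intro rat_mod_add_mult) (auto simp: zp_def)
      finally show "[rat_mod p a + rat_mod p (b p) * rat_mod p (poly f (b p)) =
          rat_mod p (poly (pCons a f) (b p))] (mod int p)"
        by simp
    qed
  qed
  finally show ?case .
qed

lemma eval_A_seq_to_A_eq_0_iff:
  assumes "\<forall>\<^sub>F p in sequentially. prime p \<longrightarrow> (\<forall>n. b n \<in> zp p)"
  shows "eval_A f (seq_to_A b) = 0 \<longleftrightarrow>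
    (\<forall>\<^sub>F p in sequentially. prime p \<longrightarrow> poly f (b p) \<in> (*) (of_nat p) ` zp p)"
  unfolding eval_A_seq_to_A[OF assms] unfolding seq_to_A_def zero_ring_A_def mk_ring_A_eq_iff
  by (rule eventually_cong[OF eventually_conj[OF assms eventually_coeffs_in_zp[of f]]])
     (auto simp: rat_mod_eq_0_iff zp.poly_coeffs_in)

section \<open>Reduction to a separable characteristic polynomial\<close>

text \<open>Take for \<open>q\<close> the product of the distinct prime factors of \<open>h\<close>.
  A prime factor common to \<open>q\<close> and its derivative would divide its own derivative,
  which is non-zero of smaller degree in characteristic zero.\<close>

lemma exists_squarefree_dvd_power:
  fixes h :: "rat poly"
  assumes "h \<noteq> 0"
  shows "\<exists>q m. lead_coeff q = 1 \<and> coprime q (pderiv q) \<and> h dvd q ^ m"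
proof -
  define q where "q = \<Prod>(prime_factors h)"
  have lead: "lead_coeff q = 1"
    unfolding q_def lead_coeff_prod
  proof (intro prod.neutral ballI)
    fix t assume t: "t \<in> prime_factors h"
    then have "normalize t = t" "t \<noteq> 0" by (auto intro: normalize_prime)
    then have "coeff (normalize t) (degree t) = 1"
      by (subst normalize_poly_eq_map_poly) (simp add: coeff_map_poly)
    then show "lead_coeff t = 1"
      using \<open>normalize t = t\<close> by simp
  qed
  have "coprime q (pderiv q)"
  proof (rule ccontr)
    assume "\<not> coprime q (pderiv q)"
    then obtain c where c: "c dvd q" "c dvd pderiv q" "\<not> is_unit c"
      by (rule not_coprimeE)
    with lead have "c \<noteq> 0" by auto
    with c obtain t where t: "prime t" "t dvd q" "t dvd pderiv q"
      using prime_divisor_exists[of c] dvd_trans by blast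
    then obtain t' where t': "t' \<in> prime_factors h" "t dvd t'"
      by (auto simp: q_def prime_dvd_prod_iff)
    with t have "t' = t" by (metis in_prime_factors_iff primes_dvd_imp_eq)
    define w where "w = \<Prod>(prime_factors h - {t})"
    have q: "q = t * w"
      using t' \<open>t' = t\<close> unfolding q_def w_def by (intro prod.remove) auto
    have "\<not> t dvd w"
    proof
      assume "t dvd w"
      then obtain u where "u \<in> prime_factors h - {t}" "t dvd u"
        using t(1) by (auto simp: w_def prime_dvd_prod_iff)
      with t(1) show False by (metis Diff_iff in_prime_factors_iff insertI1 primes_dvd_imp_eq)
    qed
    have "t dvd w * pderiv t"
      using t(3) by (simp add: q pderiv_mult dvd_add_right_iff)
    with \<open>\<not> t dvd w\<close> t(1) have "t dvd pderiv t"
      by (simp add: prime_dvd_mult_iff)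
    moreover have "degree t > 0"
      using t(1) by (metis is_unit_iff_degree not_prime_0 not_prime_unit gr0I)
    then have "pderiv t \<noteq> 0" "degree (pderiv t) < degree t"
      by (auto simp: pderiv_eq_0_iff degree_pderiv)
    ultimately show False
      by (meson dvd_imp_degree_le not_less)
  qed
  moreover have "h dvd q ^ size (prime_factorization h)"
  proof -
    have "prod_mset M dvd q ^ size M" if "set_mset M \<subseteq> prime_factors h" for M
      using that
    proof (induction M)
      case (add t M)
      then have "t dvd q" unfolding q_def by (intro dvd_prodI) auto
      with add show ?case by (simp add: mult_dvd_mono)
    qed simp
    from this[of "prime_factorization h"] show ?thesis
      using prod_mset_prime_factorization_weak[OF assms] by (metis dvd_normalize_iff normalize_dvd_iff order_refl)
  qed
  ultimately show ?thesis using lead by blast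
qed

lemma dvd_pcompose_diff:
  fixes q s t :: "'a::idom poly"
  shows "s - t dvd pcompose q s - pcompose q t"
proof (induction q)
  case (pCons a q)
  have "pcompose (pCons a q) s - pcompose (pCons a q) t =
      (s - t) * pcompose q s + t * (pcompose q s - pcompose q t)"
    by (simp add: pcompose_pCons algebra_simps)
  then show ?case
    using dvd_add[OF dvd_triv_left dvd_mult[OF pCons.IH]] by simp
qed simp

text \<open>A first-order Taylor expansion around \<open>s\<close>; its quadratic error term is what
  lets a Newton step gain a factor \<open>q\<close>.\<close>

lemma dvd_pcompose_taylor:
  fixes q s h :: "'a::idom poly"
  shows "h ^ 2 dvd pcompose q (s + h) - pcompose q s - h * pcompose (pderiv q) s"
proof (induction q)
  case (pCons a q)
  have "pcompose (pCons a q) (s + h) - pcompose (pCons a q) s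
        - h * pcompose (pderiv (pCons a q)) s =
      (s + h) * (pcompose q (s + h) - pcompose q s - h * pcompose (pderiv q) s)
        + h ^ 2 * pcompose (pderiv q) s"
    by (simp add: pcompose_pCons pderiv_pCons pcompose_add algebra_simps power2_eq_square)
  then show ?case
    using dvd_add[OF dvd_mult[OF pCons.IH] dvd_triv_left] by simp
qed simp

text \<open>Newton's iteration for the Jordan--Chevalley decomposition: modulo \<open>q ^ m\<close>, the
  polynomial \<open>s\<close> is the semisimple part of \<open>X\<close>.\<close>

lemma exists_semisimple_part:
  fixes q :: "'a::field_gcd poly"
  assumes "coprime q (pderiv q)"
  shows "\<exists>s. q dvd s - [:0, 1:] \<and> q ^ m dvd pcompose q s"
proof (induction m)
  case 0
  show ?case by (intro exI[of _ "[:0, 1:]"]) simp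
next
  case (Suc m)
  then obtain s where s: "q dvd s - [:0, 1:]" "q ^ m dvd pcompose q s" by blast
  obtain u v where uv: "u * pderiv q + v * q = 1"
    using assms by (metis bezout_coefficients_fst_snd coprime_iff_gcd_eq_1 coprime_commute)
  \<comment> \<open>Newton's correction -q(s)/q'(s): modulo \<open>q\<close>, the polynomial
    \<open>u\<close> inverts \<open>pderiv q\<close>, which agrees there with its composite with
    \<open>s\<close> because \<open>s\<close> is congruent to X.\<close>
  let ?h = "- (u * pcompose q s)"
  \<comment> \<open>For \<open>m = 0\<close> the induction hypothesis on \<open>q ^ m\<close> is
    empty, so this has to come from the congruence of \<open>s\<close> with X.\<close>
  have qs: "q dvd pcompose q s"
    using dvd_trans[OF s(1) dvd_pcompose_diff[of s "[:0, 1:]" q]]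
    unfolding pcompose_idR by (rule iffD1[OF dvd_diff_left_iff[OF dvd_refl]])
  have "q dvd pcompose (pderiv q) s - pderiv q"
    using dvd_trans[OF s(1) dvd_pcompose_diff[of s "[:0, 1:]" "pderiv q"]]
    by (simp add: pcompose_idR)
  then have "q dvd v * q - u * (pcompose (pderiv q) s - pderiv q)" by auto
  also have "v * q - u * (pcompose (pderiv q) s - pderiv q) = 1 - u * pcompose (pderiv q) s"
    using uv by (simp add: algebra_simps)
  finally have "q ^ m * q dvd pcompose q s * (1 - u * pcompose (pderiv q) s)"
    by (intro mult_dvd_mono s)
  moreover have "q ^ m * q dvd pcompose q s * pcompose q s"
    by (intro mult_dvd_mono s qs)
  then have "q ^ m * q dvd u\<^sup>2 * (pcompose q s * pcompose q s)"
    by (rule dvd_mult)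
  then have "q ^ m * q dvd ?h ^ 2" by (simp add: power2_eq_square mult_ac)
  then have "q ^ m * q dvd pcompose q (s + ?h) - pcompose q s - ?h * pcompose (pderiv q) s"
    using dvd_pcompose_taylor dvd_trans by blast
  \<comment> \<open>The linear part of the expansion is q(s) times a multiple of \<open>q\<close>,
    the error is a multiple of q(s) squared; both contain \<open>q ^ m * q\<close>.\<close>
  ultimately have "q ^ m * q dvd (pcompose q (s + ?h) - pcompose q s - ?h * pcompose (pderiv q) s)
      + pcompose q s * (1 - u * pcompose (pderiv q) s)"
    by (intro dvd_add)
  then have "q ^ Suc m dvd pcompose q (s + ?h)" by (simp add: algebra_simps)
  moreover have "q dvd (s + ?h) - [:0, 1:]"
  proof -
    have "q dvd (s - [:0, 1:]) - u * pcompose q s"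
      using s(1) qs by (rule dvd_diff[OF _ dvd_mult])
    also have "(s - [:0, 1:]) - u * pcompose q s = (s + ?h) - [:0, 1:]"
      by (simp only: diff_conv_add_uminus ac_simps)
    finally show ?thesis .
  qed
  ultimately show ?case by blast
qed

section \<open>Sequences as linear functionals on polynomials\<close>

definition seq_functional :: "(nat \<Rightarrow> 'a::comm_ring_1) \<Rightarrow> 'a poly \<Rightarrow> 'a" where
  "seq_functional a h = (\<Sum>i\<le>degree h. coeff h i * a i)"

lemma seq_functional_altdef:
  assumes "degree h \<le> n"
  shows "seq_functional a h = (\<Sum>i\<le>n. coeff h i * a i)"
  unfolding seq_functional_def
  using assms by (intro sum.mono_neutral_left) (auto simp: coeff_eq_0)

lemma seq_functional_add: "seq_functional a (g + h) = seq_functional a g + seq_functional a h"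
  using degree_add_le[of g "max (degree g) (degree h)" h]
  by (simp add: seq_functional_altdef[of _ "max (degree g) (degree h)"] sum.distrib algebra_simps)

lemma seq_functional_smult: "seq_functional a (smult c h) = c * seq_functional a h"
  using degree_smult_le[of c h]
  by (simp add: seq_functional_altdef[of _ "degree h"] sum_distrib_left mult_ac)

lemma seq_functional_diff: "seq_functional a (g - h) = seq_functional a g - seq_functional a h"
  using seq_functional_add[of a g "smult (-1) h"] seq_functional_smult[of a "-1" h] by simp

lemma seq_functional_0 [simp]: "seq_functional a 0 = 0"
  by (simp add: seq_functional_def)

lemma seq_functional_sum: "seq_functional a (sum f I) = (\<Sum>i\<in>I. seq_functional a (f i))"
  by (induction I rule: infinite_finite_induct) (auto simp: seq_functional_add)

lemma seq_functional_monom: "seq_functional a (monom c n) = c * a n"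
proof -
  have "seq_functional a (monom c n) = (\<Sum>i\<le>n. coeff (monom c n) i * a i)"
    by (rule seq_functional_altdef) (rule degree_monom_le)
  also have "\<dots> = (\<Sum>i\<le>n. if i = n then c * a n else 0)"
    by (intro sum.cong) auto
  finally show ?thesis by simp
qed

lemma seq_functional_pCons:
  "seq_functional a (pCons c h) = c * a 0 + seq_functional (\<lambda>n. a (Suc n)) h"
proof -
  have "seq_functional a (pCons c h) = (\<Sum>i\<le>Suc (degree h). coeff (pCons c h) i * a i)"
    by (rule seq_functional_altdef) (rule degree_pCons_le)
  then show ?thesis
    by (simp add: sum.atMost_Suc_shift seq_functional_def del: sum.atMost_Suc)
qed

lemma (in comm_subring) seq_functional_mem:
  "h \<in> coeffs_in R \<Longrightarrow> (\<And>n. a n \<in> R) \<Longrightarrow> seq_functional a h \<in> R"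
  by (auto simp: seq_functional_def coeffs_in_def intro!: closed)

text \<open>Replacing X by \<open>s\<close> in the functional of \<open>a\<close> gives the
  functional of a new sequence. A polynomial therefore annihilates the new sequence once its
  composite with \<open>s\<close> is annihilated by the old functional.\<close>

lemma seq_functional_pcompose:
  "seq_functional (\<lambda>n. seq_functional a (s ^ n)) h = seq_functional a (pcompose h s)"
proof -
  have "pcompose h s = (\<Sum>i\<le>degree h. smult (coeff h i) (s ^ i))"
    by (simp add: pcompose_altdef poly_altdef degree_map_poly coeff_map_poly)
  then show ?thesis
    by (simp add: seq_functional_sum seq_functional_smult, simp add: seq_functional_def)
qed

text \<open>Multiplication by X shifts the sequence, and shifted sequences satisfy the same
  recurrence; hence the functional kills the whole ideal generated by the characteristic
  polynomial.\<close>

lemma recurrence_seq_functional_eq_0: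
  assumes "\<And>n. a (n + k) = (\<Sum>i<k. c i * a (n + i))"
  shows "seq_functional a ((monom 1 k - (\<Sum>i<k. monom (c i) i)) * h) = 0"
  using assms
proof (induction h arbitrary: a)
  case (pCons x h)
  let ?q = "monom 1 k - (\<Sum>i<k. monom (c i) i)"
  have "?q * pCons x h = smult x ?q + pCons 0 (?q * h)"
    by (simp add: mult_pCons_right)
  moreover have "seq_functional a ?q = 0"
    using pCons.prems[of 0]
    by (simp add: seq_functional_diff seq_functional_sum seq_functional_monom)
  moreover have "seq_functional (\<lambda>n. a (Suc n)) (?q * h) = 0"
    by (rule pCons.IH) (use pCons.prems[of "Suc _"] in simp)
  ultimately show ?case
    by (simp only: seq_functional_add seq_functional_smult seq_functional_pCons) simp
qed simp

lemma recurrence_poly: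
  assumes "recurrent a"
  obtains q where "lead_coeff q = 1" "\<And>h. seq_functional a (q * h) = 0"
proof -
  obtain k c where rec: "\<And>n. a (n + k) = (\<Sum>i<k. c i * a (n + i))"
    using assms by (auto simp: recurrent_def)
  let ?q = "monom 1 k - (\<Sum>i<k. monom (c i) i)"
  have "coeff ?q k = 1"
    by (simp add: coeff_sum)
  moreover have "coeff ?q i = 0" if "i > k" for i
    using that by (simp add: coeff_sum)
  ultimately have "degree ?q = k"
    by (intro antisym degree_le le_degree) auto
  then have "lead_coeff ?q = 1"
    using \<open>coeff ?q k = 1\<close> by simp
  then show thesis
    using recurrence_seq_functional_eq_0[of a k c, OF rec] by (intro that)
qed

text \<open>Put \<open>b n\<close> equal to the value of the functional of \<open>a\<close> at
  \<open>s ^ n\<close>. Modulo a large prime \<open>p\<close>, \<open>s ^ p\<close> is X^p plus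
  \<open>(s - X) ^ p\<close>, and the last power is a multiple of the characteristic polynomial, so
  \<open>b p\<close> and \<open>a p\<close> agree modulo \<open>p\<close>.\<close>

lemma exists_separable_representative:
  assumes "recurrent a"
  obtains b q where "lead_coeff q = 1" "coprime q (pderiv q)" "\<And>h. seq_functional b (q * h) = 0"
    and "\<forall>\<^sub>F p in sequentially. prime p \<longrightarrow> (\<forall>n. b n \<in> zp p)" "seq_to_A a = seq_to_A b"
proof -
  obtain f where f: "lead_coeff f = 1" "\<And>h. seq_functional a (f * h) = 0"
    using recurrence_poly[OF assms] by blast
  then have "f \<noteq> 0" by auto
  then obtain q m where q: "lead_coeff q = 1" "coprime q (pderiv q)" "f dvd q ^ m"
    using exists_squarefree_dvd_power by blast
  obtain s where s: "q dvd s - [:0, 1:]" "q ^ m dvd pcompose q s"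
    using exists_semisimple_part[OF q(2)] by blast
  define b where "b = (\<lambda>n. seq_functional a (s ^ n))"
  have f0: "seq_functional a h = 0" if "f dvd h" for h
    using that f(2) by (auto elim: dvdE)
  have a_zp: "\<forall>\<^sub>F p in sequentially. prime p \<longrightarrow> (\<forall>n. a n \<in> zp p)"
    using recurrent_p_integral[OF assms] by (simp add: zp_def)
  have b_zp: "\<forall>\<^sub>F p in sequentially. prime p \<longrightarrow> (\<forall>n. b n \<in> zp p)"
    using a_zp eventually_coeffs_in_zp[of s]
    by eventually_elim (auto simp: b_def intro!: zp.seq_functional_mem zp_poly.power_mem)
  have "seq_to_A b = seq_to_A a"
    unfolding seq_to_A_eq_iff[OF b_zp a_zp]
    using a_zp eventually_coeffs_in_zp[of s] eventually_ge_at_top[of m]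
  proof eventually_elim
    case (elim p)
    show ?case
    proof
      assume p: "prime p"
      let ?X = "[:0, 1:] :: rat poly"
      have X: "?X \<in> coeffs_in (zp p)"
        by (simp add: coeffs_in_pCons_iff zp.one_mem zp.zero_mem zp_poly.zero_mem)
      then have "s - ?X \<in> coeffs_in (zp p)" using elim p by (intro zp_poly.diff_mem) auto
      then have "(?X + (s - ?X)) ^ p - (?X ^ p + (s - ?X) ^ p) \<in> (*) (of_nat p) ` coeffs_in (zp p)"
        by (intro zp_poly.power_prime_add_multiple p X)
      then obtain w where w: "w \<in> coeffs_in (zp p)" "s ^ p - (?X ^ p + (s - ?X) ^ p) = of_nat p * w"
        by auto
      \<comment> \<open>The difference \<open>s - X\<close> is nilpotent modulo
        \<open>q ^ m\<close>, and the exponent \<open>p\<close> is at least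
        \<open>m\<close>.\<close>
      have "q ^ m dvd (s - ?X) ^ p"
        using s(1) \<open>m \<le> p\<close> by (rule dvd_power_le)
      then have 1: "seq_functional a ((s - ?X) ^ p) = 0"
        using q(3) by (intro f0) (rule dvd_trans)
      have 2: "seq_functional a (?X ^ p) = a p"
        by (simp add: seq_functional_monom flip: monom_altdef[of 1 p, simplified])
      have 3: "seq_functional a (of_nat p * w) = of_nat p * seq_functional a w"
        by (simp add: of_nat_poly seq_functional_smult)
      have "s ^ p = of_nat p * w + ?X ^ p + (s - ?X) ^ p"
        using w(2) by (simp only: diff_eq_eq add.assoc)
      then have "b p = of_nat p * seq_functional a w + a p"
        by (simp only: b_def seq_functional_add 1 2 3 add_0_right)
      moreover have "seq_functional a w \<in> zp p"
        using elim p w(1) by (intro zp.seq_functional_mem) auto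
      ultimately show "b p - a p \<in> (*) (of_nat p) ` zp p" by auto
    qed
  qed
  \<comment> \<open>Passing from \<open>b\<close> to \<open>a\<close> composes \<open>q * h\<close>
    with \<open>s\<close>, and the composite of \<open>q\<close> with \<open>s\<close> is divisible
    by \<open>q ^ m\<close>, hence by \<open>f\<close>.\<close>
  moreover have "seq_functional b (q * h) = 0" for h
    unfolding b_def seq_functional_pcompose pcompose_mult
    using dvd_trans[OF q(3) s(2)] by (intro f0) auto
  ultimately show thesis
    by (intro that[OF q(1,2) _ b_zp]) auto
qed

section \<open>Algebraic numbers and primitive elements\<close>

definition rat_eval :: "rat poly \<Rightarrow> complex \<Rightarrow> complex" where
  "rat_eval h z = poly (map_poly of_rat h) z"

lemma coeff_map_poly_of_rat [simp]: "coeff (map_poly of_rat h) i = of_rat (coeff h i)"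
  by (simp add: coeff_map_poly)

lemma degree_map_poly_of_rat [simp]:
  "degree (map_poly of_rat h :: 'a::field_char_0 poly) = degree h"
  by (simp add: degree_map_poly)

lemma map_poly_of_rat_add:
  "map_poly of_rat (g + h) = (map_poly of_rat g + map_poly of_rat h :: 'a::field_char_0 poly)"
  by (rule poly_eqI) (simp add: of_rat_add)

lemma map_poly_of_rat_diff:
  "map_poly of_rat (g - h) = (map_poly of_rat g - map_poly of_rat h :: 'a::field_char_0 poly)"
  by (rule poly_eqI) (simp add: of_rat_diff)

lemma map_poly_of_rat_mult:
  "map_poly of_rat (g * h) = (map_poly of_rat g * map_poly of_rat h :: 'a::field_char_0 poly)"
  by (rule poly_eqI) (simp add: coeff_mult of_rat_sum of_rat_mult)

lemma map_poly_of_rat_pderiv: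
  "map_poly of_rat (pderiv h) = (pderiv (map_poly of_rat h) :: 'a::field_char_0 poly)"
  by (rule poly_eqI) (simp add: coeff_pderiv of_rat_mult of_rat_add)

lemma rat_eval_0 [simp]: "rat_eval 0 z = 0"
  and rat_eval_1 [simp]: "rat_eval 1 z = 1"
  and rat_eval_pCons [simp]: "rat_eval (pCons a h) z = of_rat a + z * rat_eval h z"
  and rat_eval_add: "rat_eval (g + h) z = rat_eval g z + rat_eval h z"
  and rat_eval_diff: "rat_eval (g - h) z = rat_eval g z - rat_eval h z"
  and rat_eval_mult: "rat_eval (g * h) z = rat_eval g z * rat_eval h z"
  by (simp_all add: rat_eval_def map_poly_pCons map_poly_of_rat_add map_poly_of_rat_diff
      map_poly_of_rat_mult)

lemma rat_eval_smult: "rat_eval (smult a h) z = of_rat a * rat_eval h z"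
  using rat_eval_mult[of "[:a:]" h z] by simp

lemma rat_eval_power: "rat_eval (h ^ n) z = rat_eval h z ^ n"
  by (induction n) (simp_all add: rat_eval_mult)

lemma rat_eval_sum: "rat_eval (sum f I) z = (\<Sum>i\<in>I. rat_eval (f i) z)"
  by (induction I rule: infinite_finite_induct) (simp_all add: rat_eval_add)

lemma rat_eval_prod: "rat_eval (prod f I) z = (\<Prod>i\<in>I. rat_eval (f i) z)"
  by (induction I rule: infinite_finite_induct) (simp_all add: rat_eval_mult)

lemma rat_eval_pcompose: "rat_eval (pcompose g h) z = rat_eval g (rat_eval h z)"
  by (induction g) (simp_all add: pcompose_pCons rat_eval_add rat_eval_mult)

lemma rat_eval_altdef: "rat_eval h z = (\<Sum>i\<le>degree h. of_rat (coeff h i) * z ^ i)"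
  by (simp add: rat_eval_def poly_altdef)

lemma rat_eval_of_rat: "rat_eval h (of_rat r) = of_rat (poly h r)"
  by (induction h) (simp_all add: of_rat_add of_rat_mult)

lemma algebraic_iff_rat_eval: "algebraic z \<longleftrightarrow> (\<exists>h. h \<noteq> 0 \<and> rat_eval h z = 0)"
proof
  assume "algebraic z"
  then obtain p where p: "\<forall>i. coeff p i \<in> \<rat>" "p \<noteq> 0" "poly p z = 0"
    unfolding algebraic_altdef by blast
  then obtain h where "p = map_poly of_rat h" using ratpolyE[of p] by blast
  with p have "h \<noteq> 0" "rat_eval h z = 0"
    by (auto simp: rat_eval_def)
  then show "\<exists>h. h \<noteq> 0 \<and> rat_eval h z = 0"
    by blast
next
  assume "\<exists>h. h \<noteq> 0 \<and> rat_eval h z = 0"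
  then obtain h where h: "h \<noteq> 0" "rat_eval h z = 0" by blast
  then have "map_poly of_rat h \<noteq> (0 :: complex poly)"
    by (simp add: map_poly_eq_0_iff)
  with h show "algebraic z"
    by (intro algebraicI'[of "map_poly of_rat h"]) (simp_all add: rat_eval_def)
qed

section \<open>Fields generated by one algebraic number\<close>

definition rat_adjoin :: "complex \<Rightarrow> complex set" where
  "rat_adjoin \<theta> = range (\<lambda>h. rat_eval h \<theta>)"

lemma rat_adjoin_comm_subring: "comm_subring (rat_adjoin \<theta>)"
proof -
  have "comm_subring (UNIV :: rat poly set)" by unfold_locales auto
  then show ?thesis
    unfolding rat_adjoin_def
    by (rule comm_subring.image_comm_subring) (simp_all add: rat_eval_diff rat_eval_mult)
qed

interpretation rat_adjoin: comm_subring "rat_adjoin \<theta>" for \<theta>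
  by (rule rat_adjoin_comm_subring)

lemma of_rat_mem_adjoin: "of_rat r \<in> rat_adjoin \<theta>"
  unfolding rat_adjoin_def by (rule range_eqI[of _ _ "[:r:]"]) simp

lemma self_mem_adjoin: "\<theta> \<in> rat_adjoin \<theta>"
  unfolding rat_adjoin_def by (rule range_eqI[of _ _ "[:0, 1:]"]) simp

lemma adjoin_subset: "a \<in> rat_adjoin \<theta> \<Longrightarrow> rat_adjoin a \<subseteq> rat_adjoin \<theta>"
  by (auto simp: rat_adjoin_def simp flip: rat_eval_pcompose)

interpretation QC: vector_space "\<lambda>(r::rat) (z::complex). of_rat r * z"
  by unfold_locales (simp_all add: algebra_simps of_rat_add of_rat_mult)

text \<open>More than \<open>card B\<close> distinct powers are linearly dependent over the
  rationals. Coinciding powers are treated apart, since dependence is a property of the set of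
  powers and would not see repetitions.\<close>

lemma algebraic_if_powers_in_span:
  assumes "finite B" "\<And>n. z ^ n \<in> QC.span B"
  shows "algebraic z"
proof (cases "inj_on (\<lambda>n. z ^ n) {..card B}")
  case True
  let ?S = "(\<lambda>n. z ^ n) ` {..card B}"
  have "card ?S = Suc (card B)" using True by (simp add: card_image)
  moreover have "?S \<subseteq> QC.span B" using assms(2) by auto
  ultimately have "QC.dependent ?S"
    using QC.independent_span_bound[OF assms(1), of ?S] by auto
  then obtain u where u: "\<exists>v\<in>?S. u v \<noteq> 0" "(\<Sum>v\<in>?S. of_rat (u v) * v) = 0"
    by (subst (asm) QC.dependent_finite) auto
  then obtain m where m: "m \<le> card B" "u (z ^ m) \<noteq> 0" by auto
  let ?h = "\<Sum>n\<le>card B. monom (u (z ^ n)) n"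
  have "rat_eval (monom r n) z = of_rat r * z ^ n" for r n
    by (simp add: rat_eval_def map_poly_monom poly_monom)
  then have "rat_eval ?h z = (\<Sum>n\<le>card B. of_rat (u (z ^ n)) * z ^ n)"
    by (simp add: rat_eval_sum)
  also have "\<dots> = 0" using u(2) True by (simp add: sum.reindex)
  finally have "rat_eval ?h z = 0" .
  moreover have "coeff ?h m \<noteq> 0" using m by (simp add: coeff_sum)
  then have "?h \<noteq> 0" by force
  ultimately show ?thesis unfolding algebraic_iff_rat_eval by blast
next
  case False
  then obtain m n where mn: "m < n" "z ^ m = z ^ n"
    by (metis (mono_tags, lifting) inj_onI nat_neq_iff)
  let ?h = "monom 1 n - monom 1 m :: rat poly"
  have "coeff ?h n \<noteq> 0" using mn by simp
  then have "?h \<noteq> 0" by force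
  moreover have "rat_eval ?h z = 0"
    using mn by (simp add: rat_eval_diff, simp add: rat_eval_def map_poly_monom poly_monom)
  ultimately show ?thesis unfolding algebraic_iff_rat_eval by blast
qed

text \<open>Division with remainder by an annihilating polynomial leaves only boundedly many powers
  of \<theta>.\<close>

lemma adjoin_finite_span:
  assumes "algebraic \<theta>"
  obtains B where "finite B" "rat_adjoin \<theta> \<subseteq> QC.span B"
proof -
  obtain f where f: "f \<noteq> 0" "rat_eval f \<theta> = 0"
    using assms by (auto simp: algebraic_iff_rat_eval)
  let ?B = "(\<lambda>n. \<theta> ^ n) ` {..degree f}"
  have "rat_eval h \<theta> \<in> QC.span ?B" for h
  proof -
    let ?r = "h mod f"
    have "h = f * (h div f) + ?r" by simp
    then have "rat_eval h \<theta> = rat_eval ?r \<theta>"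
      using f(2) by (metis rat_eval_add rat_eval_mult mult_zero_left add_0)
    moreover have "degree ?r \<le> degree f"
      using degree_mod_less'[of f h] f(1) by (cases "?r = 0") auto
    then have "rat_eval ?r \<theta> \<in> QC.span ?B"
      unfolding rat_eval_altdef
      by (intro QC.span_sum QC.span_scale QC.span_base) auto
    ultimately show ?thesis by simp
  qed
  then show thesis
    by (intro that[of ?B]) (auto simp: rat_adjoin_def)
qed

lemma algebraic_if_mem_adjoin:
  assumes "algebraic \<theta>" "z \<in> rat_adjoin \<theta>"
  shows "algebraic z"
proof -
  obtain B where "finite B" "rat_adjoin \<theta> \<subseteq> QC.span B"
    using adjoin_finite_span[OF assms(1)] .
  then show ?thesis
    using rat_adjoin.power_mem[OF assms(2)] by (intro algebraic_if_powers_in_span) auto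
qed

lemma mult_mem_span:
  assumes "x \<in> QC.span S" "y \<in> QC.span T"
  shows "x * y \<in> QC.span ((\<lambda>(s, t). s * t) ` (S \<times> T))"
  using assms(1)
proof (induction rule: QC.span_induct_alt)
  case base
  show ?case by (simp add: QC.span_zero)
next
  case (step r s x)
  have "s * y \<in> QC.span ((\<lambda>(s, t). s * t) ` (S \<times> T))"
    using assms(2)
  proof (induction rule: QC.span_induct_alt)
    case base
    show ?case by (simp add: QC.span_zero)
  next
    case (step r' t y)
    have "s * t \<in> QC.span ((\<lambda>(s, t). s * t) ` (S \<times> T))"
      using step \<open>s \<in> S\<close> by (intro QC.span_base) auto
    then have "of_rat r' * (s * t) + s * y \<in> QC.span ((\<lambda>(s, t). s * t) ` (S \<times> T))"
      using step by (intro QC.span_add QC.span_scale)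
    then show ?case by (simp add: algebra_simps)
  qed
  then have "of_rat r * (s * y) + x * y \<in> QC.span ((\<lambda>(s, t). s * t) ` (S \<times> T))"
    using step by (intro QC.span_add QC.span_scale)
  then show ?case by (simp add: algebra_simps)
qed

text \<open>By the binomial theorem all powers of \<open>a + b\<close> lie in the span of the
  finitely many products of spanning elements for \<open>a\<close> and for \<open>b\<close>.\<close>

lemma algebraic_add:
  fixes a b :: complex
  assumes "algebraic a" "algebraic b"
  shows "algebraic (a + b)"
proof -
  obtain S T where ST: "finite S" "rat_adjoin a \<subseteq> QC.span S" "finite T" "rat_adjoin b \<subseteq> QC.span T"
    using adjoin_finite_span assms by metis
  let ?B = "(\<lambda>(s, t). s * t) ` (S \<times> T)"
  have "(a + b) ^ n \<in> QC.span ?B" for n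
    unfolding binomial_ring
  proof (intro QC.span_sum)
    fix k
    have "a ^ k \<in> QC.span S" "b ^ (n - k) \<in> QC.span T"
      using ST rat_adjoin.power_mem[OF self_mem_adjoin] by blast+
    then have "of_rat (of_nat (n choose k)) * (a ^ k * b ^ (n - k)) \<in> QC.span ?B"
      by (intro QC.span_scale mult_mem_span)
    then show "of_nat (n choose k) * a ^ k * b ^ (n - k) \<in> QC.span ?B"
      by (simp add: mult.assoc)
  qed
  then show ?thesis using ST by (intro algebraic_if_powers_in_span[of ?B]) auto
qed

text \<open>In a polynomial relation for \<open>z\<close>, a vanishing constant term can be
  cancelled; a non-zero one expresses the inverse as a polynomial in \<open>z\<close>. So
  \<open>rat_adjoin \<theta>\<close> is the field generated by \<theta>.\<close>

lemma inverse_mem_adjoin: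
  assumes "algebraic \<theta>" "z \<in> rat_adjoin \<theta>"
  shows "inverse z \<in> rat_adjoin \<theta>"
proof (cases "z = 0")
  case False
  have "inverse z \<in> rat_adjoin z" if "h \<noteq> 0" "rat_eval h z = 0" for h
    using that
  proof (induction h)
    case (pCons a h)
    show ?case
    proof (cases "a = 0")
      case True
      then show ?thesis using pCons False by simp
    next
      case a: False
      have "z * rat_eval h z = - of_rat a"
        using pCons.prems by (simp add: add_eq_0_iff)
      then have "inverse z = of_rat (- inverse a) * rat_eval h z"
        using a False by (simp add: field_simps of_rat_minus of_rat_divide)
      then show ?thesis
        by (metis of_rat_mem_adjoin rangeI rat_adjoin.mult_mem rat_adjoin_def)
    qed
  qed simp
  then have "inverse z \<in> rat_adjoin z"
    using algebraic_if_mem_adjoin[OF assms] by (auto simp: algebraic_iff_rat_eval)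
  then show ?thesis using adjoin_subset[OF assms(2)] by blast
qed (simp add: rat_adjoin.zero_mem)

section \<open>Minimal polynomials and primitive elements\<close>

lemma exists_minimal_polynomial:
  assumes "algebraic \<theta>"
  obtains g where "lead_coeff g = 1" "rat_eval g \<theta> = 0" "degree g > 0"
    "\<And>h. rat_eval h \<theta> = 0 \<Longrightarrow> degree h < degree g \<Longrightarrow> h = 0"
proof -
  obtain f where f: "f \<noteq> 0 \<and> rat_eval f \<theta> = 0"
    "\<And>h. h \<noteq> 0 \<and> rat_eval h \<theta> = 0 \<Longrightarrow> degree f \<le> degree h"
    using assms ex_has_least_nat[of "\<lambda>h. h \<noteq> 0 \<and> rat_eval h \<theta> = 0" _ degree]
    unfolding algebraic_iff_rat_eval by blast
  have "degree f > 0"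
  proof (rule ccontr)
    assume "\<not> degree f > 0"
    then obtain a where "f = [:a:]" using degree_eq_zeroE by blast
    with f(1) show False by simp
  qed
  show thesis
  proof (rule that[of "smult (inverse (lead_coeff f)) f"])
    fix h assume "rat_eval h \<theta> = 0" "degree h < degree (smult (inverse (lead_coeff f)) f)"
    then show "h = 0" using f(1) f(2)[of h] by (cases "h = 0") auto
  qed (use f(1) \<open>degree f > 0\<close> in \<open>auto simp: rat_eval_smult\<close>)
qed

text \<open>After one factor \<open>X - b\<close> is split off, the cofactor has no root: not
  \<open>b\<close>, which is a simple root of \<open>q\<close>, and no other by assumption. It is
  thus constant, and \<open>b\<close> can be read off from the coefficients of
  \<open>h\<close>.\<close>

lemma unique_simple_root_coeffs:
  fixes h :: "complex poly"
  assumes "h \<noteq> 0" "\<And>z. poly h z = 0 \<longleftrightarrow> z = b" "h dvd q" "poly (pderiv q) b \<noteq> 0"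
  shows "coeff h 0 = - b * coeff h 1" "coeff h 1 \<noteq> 0"
proof -
  obtain k where k: "h = [:- b, 1:] * k"
    using assms(2)[of b] poly_eq_0_iff_dvd[of h b] unfolding dvd_def by blast
  have "poly k b \<noteq> 0"
  proof
    assume "poly k b = 0"
    then have "[:- b, 1:] dvd k" by (simp add: poly_eq_0_iff_dvd)
    then have "[:- b, 1:] * [:- b, 1:] dvd h"
      unfolding k by (rule mult_dvd_mono[OF dvd_refl])
    then have "[:- b, 1:] * [:- b, 1:] dvd q"
      using assms(3) by (rule dvd_trans)
    then obtain l where "q = [:- b, 1:] * ([:- b, 1:] * l)"
      unfolding dvd_def mult.assoc by blast
    then have "poly (pderiv q) b = 0"
      by (simp only: pderiv_mult poly_add poly_mult) simp
    with assms(4) show False by simp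
  qed
  then have "poly k z \<noteq> 0" for z
    using assms(2)[of z] k by (cases "z = b") auto
  then have "degree k = 0"
    using fundamental_theorem_of_algebra[of k] by (auto simp: constant_degree)
  then obtain e where "k = [:e:]" using degree_eq_zeroE by blast
  with k assms(1) show "coeff h 0 = - b * coeff h 1" "coeff h 1 \<noteq> 0" by auto
qed

text \<open>For \<theta> = a + c b with suitable \<open>c\<close>, the number \<open>b\<close> is
  the only common root of \<open>g\<close> and f(\<theta> - c X). The minimal polynomial of
  \<open>b\<close> over the field of \<theta> divides both, hence is linear, which puts
  \<open>b\<close> and then \<open>a\<close> into that field.\<close>

lemma primitive_element_two:
  assumes "algebraic a" "algebraic b"
  shows "\<exists>\<theta>. algebraic \<theta> \<and> a \<in> rat_adjoin \<theta> \<and> b \<in> rat_adjoin \<theta>"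
proof -
  obtain f where f: "f \<noteq> 0" "rat_eval f a = 0"
    using assms(1) by (auto simp: algebraic_iff_rat_eval)
  obtain g where g: "lead_coeff g = 1" "rat_eval g b = 0" "degree g > 0"
    "\<And>h. rat_eval h b = 0 \<Longrightarrow> degree h < degree g \<Longrightarrow> h = 0"
    using exists_minimal_polynomial[OF assms(2)] by metis
  have "pderiv g \<noteq> 0" "degree (pderiv g) < degree g"
    using g(3) by (auto simp: pderiv_eq_0_iff degree_pderiv)
  then have g': "rat_eval (pderiv g) b \<noteq> 0" using g(4) by blast
  have "finite {z. rat_eval f z = 0}" "finite {z. rat_eval g z = 0}"
    unfolding rat_eval_def using f g by (auto intro!: poly_roots_finite simp: map_poly_eq_0_iff)
  then have "finite ((\<lambda>(x, y). (x - a) / (b - y)) ` ({z. rat_eval f z = 0} \<times> {z. rat_eval g z = 0}))"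
    by blast
  moreover have "infinite (range (of_nat :: nat \<Rightarrow> complex))"
    by (intro range_inj_infinite) (auto intro: injI)
  \<comment> \<open>A coincidence \<theta> = x + c y of other roots with \<open>y\<close> different
    from \<open>b\<close> would force \<open>c\<close> to be one of these finitely many quotients;
    the pairs with \<open>y = b\<close> only contribute the value 0.\<close>
  ultimately obtain c :: nat where c: "of_nat c \<notin>
      (\<lambda>(x, y). (x - a) / (b - y)) ` ({z. rat_eval f z = 0} \<times> {z. rat_eval g z = 0})"
    by (metis (no_types, lifting) finite_subset image_subsetI)
  define \<theta> where "\<theta> = a + of_nat c * b"
  have alg: "algebraic \<theta>"
  proof -
    have "of_nat c * b \<in> rat_adjoin b"
      by (intro rat_adjoin.mult_mem rat_adjoin.of_nat_mem self_mem_adjoin)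
    then show ?thesis
      unfolding \<theta>_def using assms algebraic_if_mem_adjoin by (intro algebraic_add) auto
  qed
  have b_unique: "z = b" if "rat_eval g z = 0" "rat_eval f (\<theta> - of_nat c * z) = 0" for z
  proof (rule ccontr)
    assume "z \<noteq> b"
    then have "of_nat c = (\<theta> - of_nat c * z - a) / (b - z)"
      by (simp add: \<theta>_def field_simps)
    with that c show False by force
  qed
  define K where "K = rat_adjoin \<theta>"
  interpret K: comm_subring K unfolding K_def by (rule rat_adjoin_comm_subring)
  interpret KP: comm_subring "coeffs_in K" by (rule K.coeffs_in_comm_subring)
  define P where "P = (\<lambda>h. h \<in> coeffs_in K \<and> h \<noteq> 0 \<and> poly h b = 0)"
  have rat_K: "map_poly of_rat h \<in> coeffs_in K" for h
    by (simp add: coeffs_in_def K_def of_rat_mem_adjoin)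
  have "P (map_poly of_rat g)"
    using g rat_K by (auto simp: P_def rat_eval_def map_poly_eq_0_iff)
  \<comment> \<open>Least degree over \<open>K\<close> makes \<open>h\<close>, once normalised,
    divide every polynomial over \<open>K\<close> that vanishes at \<open>b\<close>.\<close>
  then obtain h where h: "P h" "\<And>k. P k \<Longrightarrow> degree h \<le> degree k"
    using ex_has_least_nat[of P _ degree] by blast
  define h1 where "h1 = smult (inverse (lead_coeff h)) h"
  have "inverse (lead_coeff h) \<in> K"
    using h(1) inverse_mem_adjoin[OF alg] by (auto simp: P_def coeffs_in_def K_def)
  then have h1: "h1 \<in> coeffs_in K" "lead_coeff h1 = 1" "poly h1 b = 0" "degree h1 = degree h"
    using h(1) by (auto simp: h1_def P_def intro!: K.smult_coeffs_in)
  have dvd: "h1 dvd k" if k: "k \<in> coeffs_in K" "poly k b = 0" for k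
  proof -
    obtain q r where qr: "r \<in> coeffs_in K" "k = h1 * q + r" "r = 0 \<or> degree r < degree h1"
      using K.monic_division[OF h1(1,2) k(1)] by blast
    with k h1 have "poly r b = 0" by simp
    with qr h(2)[of r] h1(4) have "r = 0"
      unfolding P_def by (metis not_le)
    with qr show ?thesis by simp
  qed
  have "h1 dvd map_poly of_rat g"
    using g by (intro dvd rat_K) (simp add: rat_eval_def)
  moreover have "h1 dvd pcompose (map_poly of_rat f) [:\<theta>, - of_nat c:]"
  proof (rule dvd)
    have "[:\<theta>, - of_nat c:] \<in> coeffs_in K"
      by (simp add: coeffs_in_pCons_iff KP.zero_mem K.uminus_mem K.of_nat_mem, simp add: K_def self_mem_adjoin)
    then show "pcompose (map_poly of_rat f) [:\<theta>, - of_nat c:] \<in> coeffs_in K"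
      by (intro K.pcompose_coeffs_in rat_K)
    show "poly (pcompose (map_poly of_rat f) [:\<theta>, - of_nat c:]) b = 0"
      using f(2) by (simp add: poly_pcompose \<theta>_def rat_eval_def mult.commute)
  qed
  ultimately have "poly h1 z = 0 \<longleftrightarrow> z = b" for z
  proof (intro iffI)
    assume *: "h1 dvd map_poly of_rat g" "h1 dvd pcompose (map_poly of_rat f) [:\<theta>, - of_nat c:]"
      and "poly h1 z = 0"
    then have "[:- z, 1:] dvd h1" by (simp add: poly_eq_0_iff_dvd)
    with * have "poly (map_poly of_rat g) z = 0"
      "poly (pcompose (map_poly of_rat f) [:\<theta>, - of_nat c:]) z = 0"
      unfolding poly_eq_0_iff_dvd by (blast intro: dvd_trans)+
    then show "z = b"
      by (intro b_unique) (simp_all add: rat_eval_def poly_pcompose mult.commute)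
  qed (use h1(3) in simp)
  moreover have "h1 \<noteq> 0" using h1(2) by auto
  ultimately have "coeff h1 0 = - b * coeff h1 1" "coeff h1 1 \<noteq> 0"
    using unique_simple_root_coeffs[of h1 b "map_poly of_rat g"] \<open>h1 dvd map_poly of_rat g\<close> g'
    by (simp_all add: rat_eval_def map_poly_of_rat_pderiv)
  then have "b = - (coeff h1 0 * inverse (coeff h1 1))" by (simp add: field_simps)
  also have "\<dots> \<in> K"
    using h1(1) inverse_mem_adjoin[OF alg] by (auto simp: coeffs_in_def K_def intro!: rat_adjoin.closed)
  finally have "b \<in> K" .
  moreover have "a = \<theta> - of_nat c * b" by (simp add: \<theta>_def)
  ultimately have "a \<in> K"
    using self_mem_adjoin by (auto simp: K_def intro!: rat_adjoin.closed)
  then show ?thesis using alg \<open>b \<in> K\<close> by (auto simp: K_def)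
qed

lemma primitive_element:
  assumes "finite S" "\<And>z. z \<in> S \<Longrightarrow> algebraic z"
  shows "\<exists>\<theta>. algebraic \<theta> \<and> S \<subseteq> rat_adjoin \<theta>"
  using assms
proof (induction S rule: finite_induct)
  case empty
  show ?case by (intro exI[of _ 0]) simp
next
  case (insert b S)
  then obtain a where a: "algebraic a" "S \<subseteq> rat_adjoin a" by auto
  obtain \<theta> where "algebraic \<theta>" "a \<in> rat_adjoin \<theta>" "b \<in> rat_adjoin \<theta>"
    using primitive_element_two[OF a(1)] insert.prems by blast
  with a(2) adjoin_subset[of a \<theta>] show ?case by blast
qed

section \<open>Sequences as exponential sums over the roots\<close>

lemma seq_functional_of_rat:
  "seq_functional (\<lambda>n. of_rat (b n)) (map_poly of_rat h) = (of_rat (seq_functional b h) :: 'a::field_char_0)"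
  by (simp add: seq_functional_def of_rat_sum of_rat_mult)

text \<open>A complex polynomial is a complex combination of monomials, for which the vanishing is
  the rational hypothesis.\<close>

lemma seq_functional_of_rat_eq_0:
  fixes h :: "'a::field_char_0 poly"
  assumes "\<And>h. seq_functional b (q * h) = 0"
  shows "seq_functional (\<lambda>n. of_rat (b n)) (map_poly of_rat q * h) = 0"
proof -
  have "h = (\<Sum>i\<le>degree h. smult (coeff h i) (map_poly of_rat (monom 1 i)))"
    by (simp add: map_poly_monom smult_monom poly_as_sum_of_monoms)
  then have "map_poly of_rat q * h =
      (\<Sum>i\<le>degree h. smult (coeff h i) (map_poly of_rat (q * monom 1 i)))"
    by (metis (no_types, lifting) map_poly_of_rat_mult mult_smult_right sum.cong sum_distrib_left)
  then show ?thesis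
    by (simp add: seq_functional_sum seq_functional_smult seq_functional_of_rat assms)
qed

text \<open>A Bezout identity for \<open>q\<close> and its derivative excludes common roots, so all
  roots are simple.\<close>

lemma separable_splits:
  fixes q :: "rat poly"
  assumes "lead_coeff q = 1" "coprime q (pderiv q)"
  shows "map_poly of_rat q = (\<Prod>z | rat_eval q z = 0. [:- z, 1:])"
proof -
  obtain u v where uv: "u * pderiv q + v * q = 1"
    using assms(2) by (metis bezout_coefficients_fst_snd coprime_iff_gcd_eq_1 coprime_commute)
  have "\<not> (rat_eval q z = 0 \<and> rat_eval (pderiv q) z = 0)" for z
    using arg_cong[OF uv, of "\<lambda>h. rat_eval h z"] by (auto simp: rat_eval_add rat_eval_mult)
  then have "rsquarefree (map_poly of_rat q :: complex poly)"
    by (simp add: rsquarefree_roots rat_eval_def map_poly_of_rat_pderiv)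
  from complex_poly_decompose_rsquarefree[OF this] show ?thesis
    using assms(1) by (simp add: rat_eval_def)
qed

text \<open>Lagrange interpolation: modulo \<open>Q\<close>, X^n is the combination of the basis
  polynomials \<open>L z\<close> with weights \<open>z ^ n\<close>. Applying the functional of
  \<open>b\<close> gives the formula, with the values at \<open>L z\<close> as coefficients.\<close>

lemma exponential_sum:
  assumes q: "lead_coeff q = 1" "coprime q (pderiv q)" "\<And>h. seq_functional b (q * h) = 0"
    and \<theta>: "algebraic \<theta>" "{z. rat_eval q z = 0} \<subseteq> rat_adjoin \<theta>"
  obtains c where "\<And>n. of_rat (b n) = (\<Sum>z | rat_eval q z = 0. c z * z ^ n)"
    "\<And>z. rat_eval q z = 0 \<Longrightarrow> c z \<in> rat_adjoin \<theta>"
proof -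
  define \<Lambda> where "\<Lambda> = {z. rat_eval q z = 0}"
  have fin: "finite \<Lambda>"
    unfolding \<Lambda>_def rat_eval_def using q(1) by (intro poly_roots_finite) (auto simp: map_poly_eq_0_iff)
  define Q :: "complex poly" where "Q = map_poly of_rat q"
  have Q: "Q = (\<Prod>z\<in>\<Lambda>. [:- z, 1:])"
    using separable_splits[OF q(1,2)] by (simp add: Q_def \<Lambda>_def)
  then have deg: "degree Q = card \<Lambda>"
    by (simp add: degree_prod_sum_eq)
  define L where "L = (\<lambda>z. \<Prod>w\<in>\<Lambda> - {z}. smult (inverse (z - w)) [:- w, 1:])"
  have L: "poly (L z) w = (if w = z then 1 else 0)" if "z \<in> \<Lambda>" "w \<in> \<Lambda>" for z w
  proof (cases "w = z")
    case True
    then have "inverse (z - x) * (w - x) = 1" if "x \<in> \<Lambda> - {z}" for x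
      using that by auto
    then show ?thesis
      using True by (simp add: L_def poly_prod algebra_simps)
  qed (use that fin in \<open>auto simp: L_def poly_prod prod_zero_iff\<close>)
  define B where "B = (\<lambda>n. of_rat (b n) :: complex)"
  define c where "c = (\<lambda>z. seq_functional B (L z))"
  have "B n = (\<Sum>z\<in>\<Lambda>. c z * z ^ n)" for n
  proof -
    define h where "h = monom 1 n - (\<Sum>z\<in>\<Lambda>. smult (z ^ n) (L z))"
    have "poly h w = 0" if "w \<in> \<Lambda>" for w
    proof -
      have "(\<Sum>z\<in>\<Lambda>. z ^ n * poly (L z) w) = (\<Sum>z\<in>\<Lambda>. if z = w then w ^ n else 0)"
        using that by (intro sum.cong) (auto simp: L)
      then show ?thesis
        using that fin by (simp add: h_def poly_sum poly_monom)
    qed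
    moreover have "poly Q w = 0" if "w \<in> \<Lambda>" for w
      using that fin by (auto simp: Q poly_prod prod_zero_iff)
    ultimately have roots: "\<Lambda> \<subseteq> {w. poly (h mod Q) w = 0}"
      by (auto simp: poly_mod)
    \<comment> \<open>The remainder has at least \<open>card \<Lambda>\<close> roots, but degree
      below \<open>card \<Lambda>\<close>.\<close>
    have "h mod Q = 0"
    proof (rule ccontr)
      assume nz: "h mod Q \<noteq> 0"
      then have "card \<Lambda> \<le> degree (h mod Q)"
        using card_mono[OF poly_roots_finite[OF nz] roots] card_poly_roots_bound[OF nz] by simp
      moreover have "Q \<noteq> 0" using fin by (simp add: Q prod_zero_iff)
      ultimately show False
        using degree_mod_less'[of Q h] nz deg by simp
    qed
    then have "h = Q * (h div Q)" by (metis add_0_right mult_div_mod_eq)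
    then have "seq_functional B h = 0"
      using seq_functional_of_rat_eq_0[OF q(3)] unfolding Q_def B_def by metis
    then show ?thesis
      by (simp add: h_def seq_functional_diff seq_functional_sum seq_functional_smult
          seq_functional_monom c_def mult.commute)
  qed
  moreover have "c z \<in> rat_adjoin \<theta>" if "z \<in> \<Lambda>" for z
  proof -
    interpret KP: comm_subring "coeffs_in (rat_adjoin \<theta>)" by (rule rat_adjoin.coeffs_in_comm_subring)
    have "L z \<in> coeffs_in (rat_adjoin \<theta>)"
      unfolding L_def using that \<theta>
      by (intro KP.prod_mem rat_adjoin.smult_coeffs_in inverse_mem_adjoin rat_adjoin.diff_mem)
         (auto simp: coeffs_in_pCons_iff \<Lambda>_def KP.zero_mem intro!: rat_adjoin.uminus_mem rat_adjoin.one_mem)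
    then show ?thesis
      unfolding c_def B_def by (intro rat_adjoin.seq_functional_mem of_rat_mem_adjoin)
  qed
  ultimately show thesis by (intro that) (auto simp: B_def \<Lambda>_def)
qed

section \<open>Prime divisors of polynomial values\<close>

text \<open>Euclid's argument: with \<open>a\<close> the constant term, the value at a multiple of
  \<open>a * fact N\<close> is \<open>a * u\<close> with \<open>u\<close> congruent to 1 modulo
  \<open>fact N\<close>, so every prime factor of \<open>u\<close> exceeds \<open>N\<close>.\<close>

lemma exists_prime_dvd_poly_value:
  fixes f :: "int poly"
  assumes "degree f > 0"
  shows "\<exists>p n. prime p \<and> p > N \<and> int p dvd poly f n"
proof (cases "coeff f 0 = 0")
  case True
  obtain p where "prime p" "p > N" using bigger_prime by blast
  then show ?thesis
    using True by (intro exI[of _ p] exI[of _ 0]) (simp add: poly_0_coeff_0)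
next
  case False
  define a where "a = coeff f 0"
  obtain g where g: "f = pCons a g" by (metis a_def coeff_pCons_0 pCons_cases)
  let ?m = "\<lambda>t::nat. a * fact N * int t"
  \<comment> \<open>Avoiding the finitely many arguments where \<open>f\<close> takes the values
    \<open>a\<close> and \<open>-a\<close> ensures that \<open>u\<close> is not a unit.\<close>
  have "f - [:a:] \<noteq> 0" "f + [:a:] \<noteq> 0"
    using assms by (auto simp only: right_minus_eq eq_neg_iff_add_eq_0[symmetric] degree_minus degree_pCons_0)
  then have "finite ({x. poly (f - [:a:]) x = 0} \<union> {x. poly (f + [:a:]) x = 0})"
    using poly_roots_finite by blast
  moreover have "infinite (range ?m)"
    using False by (intro range_inj_infinite) (auto intro!: injI simp: a_def)
  ultimately have "\<not> range ?m \<subseteq> {x. poly (f - [:a:]) x = 0} \<union> {x. poly (f + [:a:]) x = 0}"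
    using finite_subset by blast
  then obtain t where t: "poly (f - [:a:]) (?m t) \<noteq> 0" "poly (f + [:a:]) (?m t) \<noteq> 0"
    by blast
  define u where "u = 1 + fact N * (int t * poly g (?m t))"
  have u: "poly f (?m t) = a * u" by (simp add: g u_def algebra_simps)
  have "u \<noteq> 1" "u \<noteq> -1" using t u by auto
  then have "nat \<bar>u\<bar> \<noteq> 1" by linarith
  then obtain p where p: "prime p" "p dvd nat \<bar>u\<bar>" using prime_factor_nat by blast
  then have pu: "int p dvd u" by simp
  have "p > N"
  proof (rule ccontr)
    assume "\<not> p > N"
    then have "p dvd fact N" using p(1) by (simp add: prime_dvd_fact_iff)
    then have "int p dvd fact N" by (metis int_dvd_int_iff of_nat_fact)
    then have "int p dvd fact N * (int t * poly g (?m t))" by (rule dvd_mult2)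
    with pu have "int p dvd 1" unfolding u_def by (simp only: dvd_add_left_iff)
    with p(1) show False by auto
  qed
  with p(1) pu u show ?thesis by (intro exI[of _ p] exI[of _ "?m t"]) simp
qed

lemma clear_denominators:
  fixes g :: "rat poly"
  shows "\<exists>d f. d > 0 \<and> smult (of_int d) g = map_poly of_int f"
proof (induction g)
  case 0
  show ?case by (intro exI[of _ 1] exI[of _ 0]) simp
next
  case (pCons a g)
  then obtain d f where df: "d > 0" "smult (of_int d) g = map_poly of_int f" by blast
  obtain m k where q: "quotient_of a = (m, k)" by (cases "quotient_of a")
  have k: "k > 0" "a = of_int m / of_int k"
    using quotient_of_denom_pos[OF q] quotient_of_div[OF q] by auto
  have "smult (of_int (k * d)) (pCons a g) =
      pCons (of_int (m * d)) (smult (of_int k) (smult (of_int d) g))"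
    using k by simp
  also have "\<dots> = map_poly of_int (pCons (m * d) (smult k f))"
    by (simp add: df(2) map_poly_pCons map_poly_smult)
  finally show ?case using k(1) df(1) by (intro exI[of _ "k * d"]) auto
qed

lemma exists_prime_dvd_rat_poly_value:
  fixes g :: "rat poly"
  assumes "degree g > 0"
  shows "\<exists>p n. prime p \<and> p > N \<and> poly g (of_int n) \<in> (*) (of_nat p) ` zp p"
proof -
  obtain d f where df: "d > 0" "smult (of_int d) g = map_poly of_int f"
    using clear_denominators by blast
  have "degree g = degree f"
    using arg_cong[OF df(2), of degree] df(1) by (simp add: degree_map_poly)
  with assms have "degree f > 0" by simp
  \<comment> \<open>Primes up to \<open>d\<close> are excluded so that the cleared denominator stays
    invertible modulo \<open>p\<close>.\<close>
  then obtain p n where p: "prime p" "p > max N (nat d)" "int p dvd poly f n"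
    using exists_prime_dvd_poly_value by blast
  then obtain k where k: "poly f n = int p * k" by (auto elim: dvdE)
  have "\<not> int p dvd d" using p(2) df(1) zdvd_imp_le[of "int p" d] by auto
  then have "coprime d (int p)"
    using p(1) by (metis coprime_commute prime_imp_coprime prime_nat_int_transfer)
  moreover have "of_int d * (of_int k / of_int d) = (of_int k :: rat)" using df(1) by simp
  ultimately have "of_int k / of_int d \<in> zp p"
    using p_integralI by (simp add: zp_def)
  moreover have "poly (map_poly of_int f) (of_int n) = (of_int (poly f n) :: rat)"
    by (induction f) (simp_all add: map_poly_pCons)
  then have "of_int d * poly g (of_int n) = of_int (poly f n)"
    using arg_cong[OF df(2), of "\<lambda>h. poly h (of_int n)"] by simp
  then have "poly g (of_int n) = of_nat p * (of_int k / of_int d)"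
    using df(1) by (simp add: k field_simps)
  ultimately have "poly g (of_int n) \<in> (*) (of_nat p) ` zp p" by blast
  with p show ?thesis by auto
qed

section \<open>Reduction modulo primes\<close>

text \<open>Expanding the product, each term selects a summand \<open>\<iota> \<sigma>\<close> for
  every map \<sigma>. Some fixed \<open>z\<close> is selected often enough that the term contains
  all factors \<open>x z w\<close> with \<open>w\<close> in \<open>S\<close>, and their product lies
  in the ideal.\<close>

lemma (in comm_subring) prod_sum_mem_multiple:
  assumes "finite S" "\<And>z. z \<in> S \<Longrightarrow> k z \<in> R" "\<And>z w. z \<in> S \<Longrightarrow> w \<in> S \<Longrightarrow> x z w \<in> R"
    and mem: "\<And>z. z \<in> S \<Longrightarrow> (\<Prod>w\<in>S. x z w) \<in> (*) c ` R"
  shows "(\<Prod>\<sigma>\<in>S \<rightarrow>\<^sub>E S. \<Sum>z\<in>S. k z * x z (\<sigma> z)) \<in> (*) c ` R"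
proof -
  let ?M = "S \<rightarrow>\<^sub>E S"
  have fin: "finite ?M" using assms(1) by (simp add: finite_PiE)
  have "(\<Prod>\<sigma>\<in>?M. k (\<iota> \<sigma>) * x (\<iota> \<sigma>) (\<sigma> (\<iota> \<sigma>))) \<in> (*) c ` R" if \<iota>: "\<iota> \<in> ?M \<rightarrow>\<^sub>E S" for \<iota>
  proof -
    \<comment> \<open>Diagonal argument: otherwise every \<open>z\<close> has a value
      \<open>\<tau> z\<close> that no \<sigma> selecting \<open>z\<close> takes at \<open>z\<close>,
      which fails for the map \<tau> itself at its own selected element.\<close>
    have "\<exists>z\<in>S. \<forall>w\<in>S. \<exists>\<sigma>\<in>?M. \<iota> \<sigma> = z \<and> \<sigma> z = w"
    proof (rule ccontr)
      assume "\<not> ?thesis"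
      then obtain \<tau> where \<tau>: "\<And>z. z \<in> S \<Longrightarrow> \<tau> z \<in> S"
        "\<And>z \<sigma>. z \<in> S \<Longrightarrow> \<sigma> \<in> ?M \<Longrightarrow> \<iota> \<sigma> = z \<Longrightarrow> \<sigma> z \<noteq> \<tau> z"
        by metis
      have "restrict \<tau> S \<in> ?M" using \<tau>(1) by auto
      moreover from this have "\<iota> (restrict \<tau> S) \<in> S" by (rule PiE_mem[OF \<iota>])
      ultimately show False using \<tau>(2) by (metis restrict_apply')
    qed
    then obtain z s where z: "z \<in> S" and
      s: "\<And>w. w \<in> S \<Longrightarrow> s w \<in> ?M" "\<And>w. w \<in> S \<Longrightarrow> \<iota> (s w) = z" "\<And>w. w \<in> S \<Longrightarrow> s w z = w"
      by metis
    have inj: "inj_on s S" using s(3) by (metis inj_onI)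
    have sub: "s ` S \<subseteq> ?M" using s(1) by auto
    have in_R: "k (\<iota> \<sigma>) \<in> R" "x (\<iota> \<sigma>) (\<sigma> (\<iota> \<sigma>)) \<in> R" if "\<sigma> \<in> ?M" for \<sigma>
    proof -
      have "\<iota> \<sigma> \<in> S" using \<iota> that by auto
      moreover from this have "\<sigma> (\<iota> \<sigma>) \<in> S" using that by auto
      ultimately show "k (\<iota> \<sigma>) \<in> R" "x (\<iota> \<sigma>) (\<sigma> (\<iota> \<sigma>)) \<in> R" using assms by auto
    qed
    have "(\<Prod>\<sigma>\<in>s ` S. x (\<iota> \<sigma>) (\<sigma> (\<iota> \<sigma>))) = (\<Prod>w\<in>S. x z w)"
      by (simp add: prod.reindex[OF inj] s)
    then have "(\<Prod>\<sigma>\<in>?M. x (\<iota> \<sigma>) (\<sigma> (\<iota> \<sigma>))) =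
        (\<Prod>\<sigma>\<in>?M - s ` S. x (\<iota> \<sigma>) (\<sigma> (\<iota> \<sigma>))) * (\<Prod>w\<in>S. x z w)"
      using prod.subset_diff[OF sub fin] by metis
    also have "\<dots> \<in> (*) c ` R"
      using in_R by (intro multiple_mult' mem z prod_mem) auto
    finally have "(\<Prod>\<sigma>\<in>?M. k (\<iota> \<sigma>)) * (\<Prod>\<sigma>\<in>?M. x (\<iota> \<sigma>) (\<sigma> (\<iota> \<sigma>))) \<in> (*) c ` R"
      using in_R by (intro multiple_mult' prod_mem) auto
    then show ?thesis by (simp add: prod.distrib)
  qed
  then show ?thesis
    unfolding prod_sum_PiE[OF fin assms(1)] by (rule multiple_sum)
qed

section \<open>Congruences modulo p in the ring generated by \<theta> over Z_(p)\<close>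

definition zp_adjoin :: "nat \<Rightarrow> complex \<Rightarrow> complex set" where
  "zp_adjoin p \<theta> = (\<lambda>h. rat_eval h \<theta>) ` coeffs_in (zp p)"

lemma zp_adjoin_comm_subring: "comm_subring (zp_adjoin p \<theta>)"
  unfolding zp_adjoin_def
  by (rule zp_poly.image_comm_subring) (simp_all add: rat_eval_diff rat_eval_mult)

interpretation zp_adjoin: comm_subring "zp_adjoin p \<theta>" for p \<theta>
  by (rule zp_adjoin_comm_subring)

lemma of_rat_mem_zp_adjoin: "r \<in> zp p \<Longrightarrow> of_rat r \<in> zp_adjoin p \<theta>"
  unfolding zp_adjoin_def
  by (rule image_eqI[of _ _ "[:r:]"]) (simp_all add: coeffs_in_pCons_iff zp_poly.zero_mem)

lemma rat_eval_mem_zp_adjoin: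
  "h \<in> coeffs_in (zp p) \<Longrightarrow> x \<in> zp_adjoin p \<theta> \<Longrightarrow> rat_eval h x \<in> zp_adjoin p \<theta>"
  by (induction h)
     (auto simp: coeffs_in_pCons_iff zp_adjoin.zero_mem
       intro!: zp_adjoin.add_mem zp_adjoin.mult_mem of_rat_mem_zp_adjoin)

text \<open>The familiar factor \<open>x - y\<close> of a difference of values; that the cofactor
  stays integral lets congruences modulo \<open>p\<close> pass through polynomials.\<close>

lemma rat_eval_diff_factor:
  assumes "h \<in> coeffs_in (zp p)" "x \<in> zp_adjoin p \<theta>" "y \<in> zp_adjoin p \<theta>"
  shows "\<exists>e\<in>zp_adjoin p \<theta>. rat_eval h x - rat_eval h y = (x - y) * e"
  using assms(1)
proof (induction h)
  case 0
  show ?case by (intro bexI[of _ 0]) (auto simp: zp_adjoin.zero_mem)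
next
  case (pCons a h)
  then have h: "h \<in> coeffs_in (zp p)" by (simp add: coeffs_in_pCons_iff)
  with pCons obtain e where e: "e \<in> zp_adjoin p \<theta>" "rat_eval h x - rat_eval h y = (x - y) * e"
    by blast
  have "rat_eval (pCons a h) x - rat_eval (pCons a h) y =
      (x - y) * rat_eval h x + y * (rat_eval h x - rat_eval h y)"
    by (simp add: algebra_simps)
  also have "\<dots> = (x - y) * (rat_eval h x + y * e)"
    unfolding e(2) by (simp add: algebra_simps)
  finally show ?case
    by (rule bexI) (intro zp_adjoin.add_mem zp_adjoin.mult_mem rat_eval_mem_zp_adjoin h e(1) assms)
qed

lemma of_rat_multiple:
  assumes "r \<in> (*) (of_nat p) ` zp p"
  shows "of_rat r \<in> (*) (of_nat p) ` zp_adjoin p \<theta>"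
  using assms by (auto simp: of_rat_mult intro: of_rat_mem_zp_adjoin)

text \<open>The p-th power is additive modulo \<open>p\<close> and, by Fermat, fixes the
  coefficients; induction along Horner's scheme combines the two.\<close>

lemma frobenius_rat_eval:
  assumes "prime p" "h \<in> coeffs_in (zp p)" "x \<in> zp_adjoin p \<theta>"
  shows "rat_eval h (x ^ p) - rat_eval h x ^ p \<in> (*) (of_nat p) ` zp_adjoin p \<theta>"
  using assms(2)
proof (induction h)
  case 0
  show ?case using prime_gt_0_nat[OF assms(1)] zp_adjoin.multiple_zero by (simp add: zero_power)
next
  case (pCons a h)
  then have a: "a \<in> zp p" and h: "h \<in> coeffs_in (zp p)" by (simp_all add: coeffs_in_pCons_iff)
  let ?a = "of_rat a :: complex" and ?y = "x * rat_eval h x" and ?I = "(*) (of_nat p) ` zp_adjoin p \<theta>"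
  have 1: "(?a + ?y) ^ p - (?a ^ p + ?y ^ p) \<in> ?I"
    using a h assms
    by (intro zp_adjoin.power_prime_add_multiple zp_adjoin.mult_mem of_rat_mem_zp_adjoin
        rat_eval_mem_zp_adjoin)
  have 2: "?a ^ p - ?a \<in> ?I"
    using of_rat_multiple[OF fermat_zp[OF assms(1) a]] by (simp add: of_rat_diff of_rat_power)
  have 3: "x ^ p * (rat_eval h (x ^ p) - rat_eval h x ^ p) \<in> ?I"
    using assms pCons.IH h by (intro zp_adjoin.multiple_mult' zp_adjoin.power_mem)
  have "x ^ p * (rat_eval h (x ^ p) - rat_eval h x ^ p) - (?a ^ p - ?a) -
      ((?a + ?y) ^ p - (?a ^ p + ?y ^ p)) \<in> ?I"
    by (rule zp_adjoin.multiple_diff[OF zp_adjoin.multiple_diff[OF 3 2] 1])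
  then show ?case by (simp add: power_mult_distrib algebra_simps)
qed

text \<open>Here \<open>g\<close> is the minimal polynomial of the primitive element \<theta>, and
  \<open>C z\<close> and \<open>H z\<close> express the coefficient at \<open>z\<close> and the root
  \<open>z\<close> itself as polynomials in \<theta>. Congruences between algebraic numbers thus
  become statements about rational polynomials modulo \<open>g\<close>.\<close>

locale exponential_data =
  fixes \<theta> :: complex and g :: "rat poly" and b :: "nat \<Rightarrow> rat"
    and \<Lambda> :: "complex set" and C H :: "complex \<Rightarrow> rat poly" and q :: "rat poly"
  assumes g: "lead_coeff g = 1" "rat_eval g \<theta> = 0" "degree g > 0"
    and g_minimal: "rat_eval h \<theta> = 0 \<Longrightarrow> degree h < degree g \<Longrightarrow> h = 0"
    and fin: "finite \<Lambda>"
    and H: "z \<in> \<Lambda> \<Longrightarrow> rat_eval (H z) \<theta> = z"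
    and b_eq: "of_rat (b n) = (\<Sum>z\<in>\<Lambda>. rat_eval (C z) \<theta> * z ^ n)"
    and b_zp: "\<forall>\<^sub>F p in sequentially. prime p \<longrightarrow> (\<forall>n. b n \<in> zp p)"
    and q: "rat_eval q z = (\<Prod>w\<in>\<Lambda>. z - w)"
begin

definition good_reduction :: "nat \<Rightarrow> bool" where
  "good_reduction p \<longleftrightarrow> prime p \<and> g \<in> coeffs_in (zp p) \<and> q \<in> coeffs_in (zp p) \<and> (\<forall>n. b n \<in> zp p) \<and>
    (\<forall>z\<in>\<Lambda>. C z \<in> coeffs_in (zp p) \<and> H z \<in> coeffs_in (zp p))"

lemma eventually_good_reduction: "\<forall>\<^sub>F p in sequentially. prime p \<longrightarrow> good_reduction p"
proof -
  have "\<forall>\<^sub>F p in sequentially. \<forall>z\<in>\<Lambda>. prime p \<longrightarrow> C z \<in> coeffs_in (zp p) \<and> H z \<in> coeffs_in (zp p)"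
  proof (intro eventually_ball_finite fin ballI)
    fix z
    show "\<forall>\<^sub>F p in sequentially. prime p \<longrightarrow> C z \<in> coeffs_in (zp p) \<and> H z \<in> coeffs_in (zp p)"
      using eventually_coeffs_in_zp[of "C z"] eventually_coeffs_in_zp[of "H z"]
      by eventually_elim blast
  qed
  with eventually_coeffs_in_zp[of g] eventually_coeffs_in_zp[of q] b_zp show ?thesis
    by eventually_elim (simp add: good_reduction_def)
qed

lemma minimal_polynomial_dvd:
  assumes "g \<in> coeffs_in (zp p)" "h \<in> coeffs_in (zp p)" "rat_eval h \<theta> = 0"
  shows "\<exists>k\<in>coeffs_in (zp p). h = g * k"
proof -
  obtain k r where kr: "k \<in> coeffs_in (zp p)" "h = g * k + r" "r = 0 \<or> degree r < degree g"
    using zp.monic_division[OF assms(1) g(1) assms(2)] by blast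
  with assms(3) g(2) have "rat_eval r \<theta> = 0" by (simp add: rat_eval_add rat_eval_mult)
  with kr(3) g_minimal have "r = 0" by blast
  with kr show ?thesis by auto
qed

text \<open>If \<open>p\<close> divides \<open>g(n)\<close>, then \<open>\<theta> \<mapsto> n\<close> maps all \<open>\<lambda> \<in> \<Lambda>\<close> to the prime field, where
  \<open>\<lambda> ^ p = \<lambda>\<close>.\<close>

lemma exists_prime_cong_first:
  "\<exists>p. p > N \<and> prime p \<and> b p - b 1 \<in> (*) (of_nat p) ` zp p"
proof -
  obtain M where M: "\<And>p. p \<ge> M \<Longrightarrow> prime p \<Longrightarrow> good_reduction p"
    using eventually_good_reduction by (auto simp: eventually_sequentially)
  obtain p n where p: "prime p" "p > max N M" "poly g (of_int n) \<in> (*) (of_nat p) ` zp p"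
    using exists_prime_dvd_rat_poly_value[OF g(3)] by blast
  have good: "good_reduction p" using M p by simp
  \<comment> \<open>The identity between \<open>b p - b 1\<close> and the sum of the
    \<open>c (z ^ p - z)\<close>, lifted to a polynomial vanishing at \<theta>. It is a multiple of
    \<open>g\<close> over Z_(p), so its value at \<open>n\<close> is a multiple of
    \<open>p\<close>.\<close>
  let ?T = "(\<Sum>z\<in>\<Lambda>. C z * (H z ^ p - H z)) - [:b p - b 1:]"
  have "?T \<in> coeffs_in (zp p)"
    using good
    by (intro zp_poly.diff_mem zp_poly.sum_mem zp_poly.mult_mem zp_poly.power_mem)
       (auto simp: good_reduction_def coeffs_in_pCons_iff zp_poly.zero_mem intro: zp.diff_mem)
  moreover have "rat_eval ?T \<theta> = 0"
    using b_eq[of p] b_eq[of 1]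
    by (simp add: rat_eval_diff rat_eval_sum rat_eval_mult rat_eval_power H of_rat_diff
        sum_subtractf right_diff_distrib)
  moreover have "g \<in> coeffs_in (zp p)" using good by (simp add: good_reduction_def)
  ultimately obtain k where k: "k \<in> coeffs_in (zp p)" "?T = g * k"
    using minimal_polynomial_dvd by blast
  have "poly ?T (of_int n) \<in> (*) (of_nat p) ` zp p"
    unfolding k(2) poly_mult by (intro zp.multiple_mult p zp.poly_coeffs_in k of_int_zp)
  moreover have "(\<Sum>z\<in>\<Lambda>. poly (C z) (of_int n) * (poly (H z) (of_int n) ^ p - poly (H z) (of_int n)))
      \<in> (*) (of_nat p) ` zp p"
    using good by (intro zp.multiple_sum zp.multiple_mult' fermat_zp zp.poly_coeffs_in of_int_zp)
      (auto simp: good_reduction_def)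
  ultimately have "(\<Sum>z\<in>\<Lambda>. poly (C z) (of_int n) * (poly (H z) (of_int n) ^ p - poly (H z) (of_int n)))
      - poly ?T (of_int n) \<in> (*) (of_nat p) ` zp p"
    by (rule zp.multiple_diff[rotated])
  then have "b p - b 1 \<in> (*) (of_nat p) ` zp p"
    by (simp add: poly_sum poly_power)
  with p show ?thesis by auto
qed

text \<open>Monic division gives each element of the ring an integral representative of degree below
  that of \<open>g\<close>. By minimality of \<open>g\<close>, the representative of the rational
  number \<open>r / p\<close> is that constant, which is therefore
  \<open>p\<close>-integral.\<close>

lemma multiple_zp_adjoin_rational:
  assumes "good_reduction p" "of_rat r \<in> (*) (of_nat p) ` zp_adjoin p \<theta>"
  shows "r \<in> (*) (of_nat p) ` zp p"
proof -
  have p: "p > 0" "g \<in> coeffs_in (zp p)"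
    using assms(1) by (auto simp: good_reduction_def prime_gt_0_nat)
  obtain h where h: "h \<in> coeffs_in (zp p)" "of_rat r = of_nat p * rat_eval h \<theta>"
    using assms(2) by (auto simp: zp_adjoin_def)
  obtain k s where ks: "s \<in> coeffs_in (zp p)" "h = g * k + s" "s = 0 \<or> degree s < degree g"
    using zp.monic_division[OF p(2) g(1) h(1)] by blast
  have "rat_eval s \<theta> = of_rat (r / of_nat p)"
    using h(2) p(1) g(2) by (simp add: ks(2) rat_eval_add rat_eval_mult of_rat_divide)
  then have "rat_eval (s - [:r / of_nat p:]) \<theta> = 0" by (simp add: rat_eval_diff)
  moreover have "degree (s - [:r / of_nat p:]) < degree g"
    using ks(3) g(3) by (intro degree_diff_less) auto
  ultimately have "s = [:r / of_nat p:]" using g_minimal by fastforce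
  with ks(1) have "r / of_nat p \<in> zp p" by (simp add: coeffs_in_pCons_iff)
  then show ?thesis using p(1) by (intro image_eqI[of _ _ "r / of_nat p"]) auto
qed

text \<open>Taking the product over all maps \<open>\<sigma>\<close> avoids the choice of a prime above \<open>p\<close>, modulo which
  Frobenius would be a single permutation of \<open>\<Lambda>\<close>.\<close>

lemma annihilating_polynomial:
  "\<exists>f. f \<noteq> 0 \<and> (\<forall>\<^sub>F p in sequentially. prime p \<longrightarrow> poly f (b p) \<in> (*) (of_nat p) ` zp p)"
proof -
  let ?M = "\<Lambda> \<rightarrow>\<^sub>E \<Lambda>"
  define c where "c = (\<lambda>z. rat_eval (C z) \<theta>)"
  \<comment> \<open>The values that \<open>b p\<close> could take modulo \<open>p\<close> when every
    \<open>z ^ p\<close> is replaced by an element of \<Lambda>.\<close>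
  define \<beta> where "\<beta> = (\<lambda>\<sigma>. \<Sum>z\<in>\<Lambda>. c z * \<sigma> z)"
  have finM: "finite ?M" using fin by (simp add: finite_PiE)
  have "algebraic \<theta>" unfolding algebraic_iff_rat_eval using g by (intro exI[of _ g]) auto
  have \<Lambda>_mem: "z \<in> rat_adjoin \<theta>" if "z \<in> \<Lambda>" for z
    using H[OF that] by (metis rangeI rat_adjoin_def)
  have "algebraic (\<beta> \<sigma>)" if "\<sigma> \<in> ?M" for \<sigma>
  proof (rule algebraic_if_mem_adjoin[OF \<open>algebraic \<theta>\<close>])
    show "\<beta> \<sigma> \<in> rat_adjoin \<theta>"
      unfolding \<beta>_def
    proof (intro rat_adjoin.sum_mem rat_adjoin.mult_mem)
      fix z assume "z \<in> \<Lambda>"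
      then show "\<sigma> z \<in> rat_adjoin \<theta>" using that by (intro \<Lambda>_mem) auto
      show "c z \<in> rat_adjoin \<theta>" by (auto simp: c_def rat_adjoin_def)
    qed
  qed
  then have "\<forall>\<sigma>\<in>?M. \<exists>f. f \<noteq> 0 \<and> rat_eval f (\<beta> \<sigma>) = 0"
    by (simp add: algebraic_iff_rat_eval)
  then obtain F where F: "\<And>\<sigma>. \<sigma> \<in> ?M \<Longrightarrow> F \<sigma> \<noteq> 0" "\<And>\<sigma>. \<sigma> \<in> ?M \<Longrightarrow> rat_eval (F \<sigma>) (\<beta> \<sigma>) = 0"
    by metis
  have "\<forall>\<^sub>F p in sequentially. \<forall>\<sigma>\<in>?M. prime p \<longrightarrow> F \<sigma> \<in> coeffs_in (zp p)"
    by (intro eventually_ball_finite finM ballI eventually_coeffs_in_zp)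
  then have "\<forall>\<^sub>F p in sequentially. prime p \<longrightarrow> poly (\<Prod>\<sigma>\<in>?M. F \<sigma>) (b p) \<in> (*) (of_nat p) ` zp p"
    using eventually_good_reduction
  proof (eventually_elim, intro impI)
    fix p
    assume "\<forall>\<sigma>\<in>?M. prime p \<longrightarrow> F \<sigma> \<in> coeffs_in (zp p)" "prime p \<longrightarrow> good_reduction p" and p: "prime p"
    then have F_zp: "\<And>\<sigma>. \<sigma> \<in> ?M \<Longrightarrow> F \<sigma> \<in> coeffs_in (zp p)" and good: "good_reduction p" by auto
    let ?R = "zp_adjoin p \<theta>" and ?b = "of_rat (b p) :: complex"
    have \<Lambda>_R: "z \<in> ?R" if "z \<in> \<Lambda>" for z
      using H[OF that] good that unfolding zp_adjoin_def good_reduction_def by (metis image_eqI)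
    have c_R: "c z \<in> ?R" if "z \<in> \<Lambda>" for z
      using good that unfolding zp_adjoin_def good_reduction_def c_def by blast
    have \<beta>_R: "\<beta> \<sigma> \<in> ?R" if "\<sigma> \<in> ?M" for \<sigma>
      unfolding \<beta>_def using that
      by (intro zp_adjoin.sum_mem zp_adjoin.mult_mem c_R \<Lambda>_R) auto
    have b_R: "?b \<in> ?R" using good by (intro of_rat_mem_zp_adjoin) (simp add: good_reduction_def)
    \<comment> \<open>By Frobenius, q(z^p) is congruent to q(z)^p, which is zero. As
      \<open>p\<close> need not generate a prime ideal, only the product over \<open>w\<close>, and
      no single factor, is known to be a multiple of \<open>p\<close>.\<close>
    have frob: "(\<Prod>w\<in>\<Lambda>. z ^ p - w) \<in> (*) (of_nat p) ` ?R" if "z \<in> \<Lambda>" for z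
    proof -
      have "rat_eval q z = 0" using that fin by (auto simp: q prod_zero_iff)
      moreover have "rat_eval q (z ^ p) - rat_eval q z ^ p \<in> (*) (of_nat p) ` ?R"
        using good by (intro frobenius_rat_eval p \<Lambda>_R that) (simp add: good_reduction_def)
      ultimately have "rat_eval q (z ^ p) \<in> (*) (of_nat p) ` ?R"
        using prime_gt_0_nat[OF p] by (simp only: zero_power diff_0_right)
      then show ?thesis by (simp only: q)
    qed
    have "(\<Prod>\<sigma>\<in>?M. \<Sum>z\<in>\<Lambda>. c z * (z ^ p - \<sigma> z)) \<in> (*) (of_nat p) ` ?R"
      by (rule zp_adjoin.prod_sum_mem_multiple[OF fin c_R _ frob])
         (assumption | rule zp_adjoin.diff_mem[OF zp_adjoin.power_mem[OF \<Lambda>_R] \<Lambda>_R])+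
    also have "(\<Prod>\<sigma>\<in>?M. \<Sum>z\<in>\<Lambda>. c z * (z ^ p - \<sigma> z)) = (\<Prod>\<sigma>\<in>?M. ?b - \<beta> \<sigma>)"
      unfolding b_eq \<beta>_def c_def right_diff_distrib sum_subtractf ..
    finally have mem: "(\<Prod>\<sigma>\<in>?M. ?b - \<beta> \<sigma>) \<in> (*) (of_nat p) ` ?R" .
    \<comment> \<open>\<open>F \<sigma>\<close> vanishes at \<open>\<beta> \<sigma>\<close>, so its
      value at \<open>b p\<close> inherits the factor \<open>b p - \<beta> \<sigma>\<close>.\<close>
    have "\<exists>e\<in>?R. rat_eval (F \<sigma>) ?b = (?b - \<beta> \<sigma>) * e" if "\<sigma> \<in> ?M" for \<sigma>
      using rat_eval_diff_factor[OF F_zp[OF that] b_R \<beta>_R[OF that]] unfolding F(2)[OF that]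
      by (simp only: diff_0_right)
    then obtain e where e: "\<And>\<sigma>. \<sigma> \<in> ?M \<Longrightarrow> e \<sigma> \<in> ?R"
      "\<And>\<sigma>. \<sigma> \<in> ?M \<Longrightarrow> rat_eval (F \<sigma>) ?b = (?b - \<beta> \<sigma>) * e \<sigma>"
      by metis
    have "of_rat (poly (\<Prod>\<sigma>\<in>?M. F \<sigma>) (b p)) = (\<Prod>\<sigma>\<in>?M. (?b - \<beta> \<sigma>) * e \<sigma>)"
      unfolding rat_eval_of_rat[symmetric] rat_eval_prod by (intro prod.cong refl e(2))
    also have "\<dots> \<in> (*) (of_nat p) ` ?R"
      unfolding prod.distrib using mem e(1) by (intro zp_adjoin.multiple_mult zp_adjoin.prod_mem)
    finally show "poly (\<Prod>\<sigma>\<in>?M. F \<sigma>) (b p) \<in> (*) (of_nat p) ` zp p"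
      by (rule multiple_zp_adjoin_rational[OF good])
  qed
  moreover have "(\<Prod>\<sigma>\<in>?M. F \<sigma>) \<noteq> 0" using finM F(1) by (simp add: prod_zero_iff)
  ultimately show ?thesis by blast
qed

text \<open>For arbitrarily large primes \<open>b p\<close> is congruent to \<open>b 1\<close>, so
  f(b 1) is divisible by arbitrarily large primes; a non-zero rational number is a unit in Z_(p) for
  all large \<open>p\<close>.\<close>

lemma poly_first_eq_0:
  assumes "\<forall>\<^sub>F p in sequentially. prime p \<longrightarrow> poly f (b p) \<in> (*) (of_nat p) ` zp p"
  shows "poly f (b 1) = 0"
proof (rule ccontr)
  assume nz: "poly f (b 1) \<noteq> 0"
  let ?r = "inverse (poly f (b 1))"
  have "\<forall>\<^sub>F p in sequentially. prime p \<longrightarrow> ?r \<in> zp p"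
    using eventually_p_integral[of ?r] by (simp add: zp_def)
  with assms eventually_good_reduction eventually_coeffs_in_zp[of f]
  have "\<forall>\<^sub>F p in sequentially. prime p \<longrightarrow> good_reduction p \<and> f \<in> coeffs_in (zp p) \<and> ?r \<in> zp p \<and>
      poly f (b p) \<in> (*) (of_nat p) ` zp p"
    by eventually_elim auto
  then obtain N where N: "\<And>p. p \<ge> N \<Longrightarrow> prime p \<Longrightarrow> good_reduction p \<and> f \<in> coeffs_in (zp p) \<and> ?r \<in> zp p \<and>
      poly f (b p) \<in> (*) (of_nat p) ` zp p"
    by (auto simp: eventually_sequentially)
  obtain p where p: "p > N" "prime p" "b p - b 1 \<in> (*) (of_nat p) ` zp p"
    using exists_prime_cong_first by blast
  with N[of p] have good: "good_reduction p" "f \<in> coeffs_in (zp p)" "?r \<in> zp p"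
    "poly f (b p) \<in> (*) (of_nat p) ` zp p" by auto
  have b_R: "of_rat (b n) \<in> zp_adjoin p \<theta>" for n
    using good(1) by (intro of_rat_mem_zp_adjoin) (simp add: good_reduction_def)
  obtain e where e: "e \<in> zp_adjoin p \<theta>"
    "rat_eval f (of_rat (b p)) - rat_eval f (of_rat (b 1)) = (of_rat (b p) - of_rat (b 1)) * e"
    using rat_eval_diff_factor[OF good(2) b_R b_R] by blast
  have "of_rat (b p - b 1) * e \<in> (*) (of_nat p) ` zp_adjoin p \<theta>"
    by (intro zp_adjoin.multiple_mult of_rat_multiple p e)
  also have "of_rat (b p - b 1) * e = of_rat (poly f (b p) - poly f (b 1))"
    using e(2) by (simp add: rat_eval_of_rat of_rat_diff)
  finally have "poly f (b p) - poly f (b 1) \<in> (*) (of_nat p) ` zp p"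
    by (rule multiple_zp_adjoin_rational[OF good(1)])
  with good(4) have "poly f (b p) - (poly f (b p) - poly f (b 1)) \<in> (*) (of_nat p) ` zp p"
    by (rule zp.multiple_diff)
  then have "poly f (b 1) * ?r \<in> (*) (of_nat p) ` zp p"
    using good(3) by (intro zp.multiple_mult) simp_all
  then have "1 \<in> (*) (of_nat p) ` zp p" using nz by simp
  then have "[rat_mod p 1 = 0] (mod int p)"
    using rat_mod_eq_0_iff[OF p(2) zp.one_mem] by simp
  moreover have "[rat_mod p 1 = 1] (mod int p)"
    using cong_modular_inverse1[of 1 "int p"] by (simp add: rat_mod_def)
  ultimately have "[0 = 1] (mod int p)" by (metis cong_sym cong_trans)
  then show False using prime_gt_1_nat[OF p(2)] by (simp add: cong_def)
qed

end

section \<open>From a recurrent sequence to an instance of \<open>exponential_data\<close>\<close>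

theorem theorem1p4:
  fixes \<alpha> :: ring_A
  assumes "\<alpha> \<in> P0_A"
  shows "(\<exists>f :: rat poly. f \<noteq> 0 \<and> eval_A f \<alpha> = 0) \<and>
         (\<forall>f :: rat poly. f \<noteq> 0 \<and> eval_A f \<alpha> = 0 \<longrightarrow> (\<exists>r :: rat. poly f r = 0))"
proof -
  obtain a where a: "recurrent a" "\<alpha> = seq_to_A a"
    using assms by (auto simp: P0_A_def)
  obtain b q where q: "lead_coeff q = 1" "coprime q (pderiv q)" "\<And>h. seq_functional b (q * h) = 0"
    and b: "\<forall>\<^sub>F p in sequentially. prime p \<longrightarrow> (\<forall>n. b n \<in> zp p)" "seq_to_A a = seq_to_A b"
    by (rule exists_separable_representative[OF a(1)]) (rule that)
  define \<Lambda> where "\<Lambda> = {z. rat_eval q z = 0}"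
  have "q \<noteq> 0" using q(1) by auto
  then have fin: "finite \<Lambda>"
    unfolding \<Lambda>_def rat_eval_def by (intro poly_roots_finite) (simp add: map_poly_eq_0_iff)
  have "algebraic z" if "z \<in> \<Lambda>" for z
    using that \<open>q \<noteq> 0\<close> unfolding algebraic_iff_rat_eval \<Lambda>_def by blast
  then obtain \<theta> where \<theta>: "algebraic \<theta>" "\<Lambda> \<subseteq> rat_adjoin \<theta>"
    using primitive_element[OF fin] by blast
  obtain c where c: "\<And>n. of_rat (b n) = (\<Sum>z | rat_eval q z = 0. c z * z ^ n)"
    "\<And>z. rat_eval q z = 0 \<Longrightarrow> c z \<in> rat_adjoin \<theta>"
    by (rule exponential_sum[OF q \<theta>[unfolded \<Lambda>_def]]) (rule that)
  obtain g where g: "lead_coeff g = 1" "rat_eval g \<theta> = 0" "degree g > 0"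
    "\<And>h. rat_eval h \<theta> = 0 \<Longrightarrow> degree h < degree g \<Longrightarrow> h = 0"
    by (rule exists_minimal_polynomial[OF \<theta>(1)]) (rule that)
  have "\<exists>h. c z = rat_eval h \<theta>" "\<exists>h. rat_eval h \<theta> = z" if "z \<in> \<Lambda>" for z
    using that c(2)[of z] \<theta>(2) unfolding \<Lambda>_def rat_adjoin_def by blast+
  then obtain C H where CH: "\<And>z. z \<in> \<Lambda> \<Longrightarrow> c z = rat_eval (C z) \<theta>"
    "\<And>z. z \<in> \<Lambda> \<Longrightarrow> rat_eval (H z) \<theta> = z"
    by metis
  have q_prod: "rat_eval q z = (\<Prod>w\<in>\<Lambda>. z - w)" for z
    using separable_splits[OF q(1,2)]
    by (simp add: rat_eval_def[of q z] poly_prod \<Lambda>_def)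
  interpret exponential_data \<theta> g b \<Lambda> C H q
  proof
    show "of_rat (b n) = (\<Sum>z\<in>\<Lambda>. rat_eval (C z) \<theta> * z ^ n)" for n
      unfolding c(1) \<Lambda>_def[symmetric] using CH(1) by simp
  qed (fact g fin CH(2) b(1) q_prod)+
  show ?thesis
    unfolding a(2) b(2) eval_A_seq_to_A_eq_0_iff[OF b(1)]
    using annihilating_polynomial poly_first_eq_0 by blast
qed

end
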